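(* Consider an action of the additive group $\mathbb G_a=\Bbbk^+$ on $\mathbb A^n$ and assume that the fixed point set $(\mathbb A^n)^{\mathbb G_a}$ is a hypersurface with an isolated singularity. Then the action is not stably triangulable.
   Context: $\Bbbk$ is an algebraically closed field of characteristic zero; actions are regular (algebraic). The fixed point set is considered as a (reduced) closed subvariety of $\mathbb A^n$; having an isolated singularity means having a singular point which is isolated in the singular locus. A $\mathbb G_a$-action on $\mathbb A^m$ is triangulable if the image of $\mathbb G_a$ in $\operatorname{Aut}(\mathbb A^m)$ is conjugate in $\operatorname{Aut}(\mathbb A^m)$ to a subgroup of the de Jonquières subgroup $\operatorname{Jonq}(m)$, which consists of the automorphisms of the form $(a_1x_1+f_1,\ a_2x_2+f_2(x_1),\ \ldots,\ a_mx_m+f_m(x_1,\ldots,x_{m-1}))$ with $a_i\in\Bbbk^*$ and $f_i\in\Bbbk[x_1,\ldots,x_{i-1}]$. A $\mathbb G_a$-action on $\mathbb A^n$ is stably triangulable if for a suitable $d\ge1$ the action on $\mathbb A^n\times\mathbb A^d\simeq\mathbb A^{n+d}$, given by the original action on $\mathbb A^n$ and the trivial action on $\mathbb A^d$, is triangulable. *)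

theory Defs
  imports
    "HOL-Library.Poly_Mapping"
    "HOL-Computational_Algebra.Polynomial"
    "HOL-Algebra.Group_Action"
    "Jordan_Normal_Form.VS_Connect"
begin

text \<open>Affine \<open>n\<close>-space over \<open>'k\<close> is \<^term>\<open>carrier_vec n\<close>, with coordinates
  \<open>x $ 0, \<dots>, x $ (n - 1)\<close>. A polynomial is a finitely supported family of coefficients
  indexed by exponent vectors; the set \<open>poly_ring n\<close> below is \<open>k[x\<^sub>0, \<dots>, x\<^sub>n\<^sub>-\<^sub>1]\<close>.\<close>

type_synonym 'k mvpoly = "(nat \<Rightarrow>\<^sub>0 nat) \<Rightarrow>\<^sub>0 'k"

definition poly_ring :: "nat \<Rightarrow> 'k::comm_ring_1 mvpoly set" where
  "poly_ring n = {P. \<forall>m \<in> Poly_Mapping.keys P. Poly_Mapping.keys m \<subseteq> {..<n}}"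

definition eval_poly :: "'k::comm_ring_1 mvpoly \<Rightarrow> 'k vec \<Rightarrow> 'k" where
  "eval_poly P x = (\<Sum>m \<in> Poly_Mapping.keys P. Poly_Mapping.lookup P m *
     (\<Prod>i \<in> Poly_Mapping.keys m. (x $ i) ^ Poly_Mapping.lookup m i))"

text \<open>Formal partial derivative; terms not containing the \<open>i\<close>-th variable get the coefficient
  \<open>0\<close>, so the truncated subtraction of exponents is harmless.\<close>

definition partial_deriv :: "nat \<Rightarrow> 'k::comm_ring_1 mvpoly \<Rightarrow> 'k mvpoly" where
  "partial_deriv i P = (\<Sum>m \<in> Poly_Mapping.keys P.
     Poly_Mapping.single (m - Poly_Mapping.single i 1)
       (of_nat (Poly_Mapping.lookup m i) * Poly_Mapping.lookup P m))"

definition regular_function :: "nat \<Rightarrow> ('k::comm_ring_1 vec \<Rightarrow> 'k) \<Rightarrow> bool" where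
  "regular_function n f \<longleftrightarrow> (\<exists>P \<in> poly_ring n. \<forall>x \<in> carrier_vec n. f x = eval_poly P x)"

definition regular_map :: "nat \<Rightarrow> nat \<Rightarrow> ('k::comm_ring_1 vec \<Rightarrow> 'k vec) \<Rightarrow> bool" where
  "regular_map m n F \<longleftrightarrow> F \<in> carrier_vec m \<rightarrow> carrier_vec n \<and>
     (\<forall>i<n. regular_function m (\<lambda>x. F x $ i))"

definition aut_group :: "nat \<Rightarrow> ('k::comm_ring_1 vec \<Rightarrow> 'k vec) monoid" where
  "aut_group n = BijGroup (carrier_vec n) \<lparr>carrier :=
     {f \<in> Bij (carrier_vec n). regular_map n n f \<and> regular_map n n (inv_into (carrier_vec n) f)}\<rparr>"

definition jonq :: "nat \<Rightarrow> ('k::field vec \<Rightarrow> 'k vec) set" where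
  "jonq n = {g \<in> carrier (aut_group n). \<exists>a f. \<forall>i<n. a i \<noteq> 0 \<and> f i \<in> poly_ring i \<and>
     (\<forall>x \<in> carrier_vec n. g x $ i = a i * x $ i + eval_poly (f i) x)}"


definition additive_group :: "'k::ab_group_add monoid" where
  "additive_group = \<lparr>carrier = UNIV, mult = (+), one = 0\<rparr>"

text \<open>Regularity refers to the action morphism on \<open>\<bbbA>\<^sup>n \<times> \<bbbG>\<^sub>a = \<bbbA>\<^sup>n\<^sup>+\<^sup>1\<close>, where the last coordinate
  of a point is the group parameter.\<close>

definition regular_Ga_action :: "nat \<Rightarrow> ('k::field \<Rightarrow> 'k vec \<Rightarrow> 'k vec) \<Rightarrow> bool" where
  "regular_Ga_action n \<phi> \<longleftrightarrow> group_action additive_group (carrier_vec n) \<phi> \<and>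
     regular_map (n + 1) n (\<lambda>z. \<phi> (z $ n) (vec_first z n))"

definition fixed_points :: "nat \<Rightarrow> ('k \<Rightarrow> 'k vec \<Rightarrow> 'k vec) \<Rightarrow> 'k vec set" where
  "fixed_points n \<phi> = {x \<in> carrier_vec n. \<forall>t. \<phi> t x = x}"

definition triangulable :: "nat \<Rightarrow> ('k::field \<Rightarrow> 'k vec \<Rightarrow> 'k vec) \<Rightarrow> bool" where
  "triangulable m \<phi> \<longleftrightarrow> (\<exists>\<psi> \<in> carrier (aut_group m). \<exists>H. subgroup H (aut_group m) \<and> H \<subseteq> jonq m \<and>
     (\<lambda>g. \<psi> \<otimes>\<^bsub>aut_group m\<^esub> g \<otimes>\<^bsub>aut_group m\<^esub> inv\<^bsub>aut_group m\<^esub> \<psi>) ` range \<phi> = H)"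

definition trivial_extension ::
    "nat \<Rightarrow> nat \<Rightarrow> ('k \<Rightarrow> 'k vec \<Rightarrow> 'k vec) \<Rightarrow> 'k \<Rightarrow> 'k vec \<Rightarrow> 'k vec" where
  "trivial_extension n d \<phi> t =
     (\<lambda>z \<in> carrier_vec (n + d). \<phi> t (vec_first z n) @\<^sub>v vec_last z d)"

definition stably_triangulable :: "nat \<Rightarrow> ('k::field \<Rightarrow> 'k vec \<Rightarrow> 'k vec) \<Rightarrow> bool" where
  "stably_triangulable n \<phi> \<longleftrightarrow> (\<exists>d\<ge>1. triangulable (n + d) (trivial_extension n d \<phi>))"


definition zero_locus :: "nat \<Rightarrow> 'k::comm_ring_1 mvpoly set \<Rightarrow> 'k vec set" where
  "zero_locus n F = {x \<in> carrier_vec n. \<forall>f \<in> F. eval_poly f x = 0}"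

definition zariski_closed :: "nat \<Rightarrow> 'k::comm_ring_1 vec set \<Rightarrow> bool" where
  "zariski_closed n Z \<longleftrightarrow> (\<exists>F \<subseteq> poly_ring n. Z = zero_locus n F)"

definition hypersurface :: "nat \<Rightarrow> 'k::comm_ring_1 vec set \<Rightarrow> bool" where
  "hypersurface n X \<longleftrightarrow>
     (\<exists>f \<in> poly_ring n. (\<forall>c. f \<noteq> Poly_Mapping.single 0 c) \<and> X = zero_locus n {f})"

definition vanishing_ideal :: "nat \<Rightarrow> 'k::comm_ring_1 vec set \<Rightarrow> 'k mvpoly set" where
  "vanishing_ideal n X = {f \<in> poly_ring n. \<forall>x \<in> X. eval_poly f x = 0}"

text \<open>The Zariski tangent space at \<open>p\<close> of \<open>X\<close> with its reduced structure, as a linear subspace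
  of \<open>k\<^sup>n\<close>.\<close>

definition tangent_space :: "nat \<Rightarrow> 'k::comm_ring_1 vec set \<Rightarrow> 'k vec \<Rightarrow> 'k vec set" where
  "tangent_space n X p = {v \<in> carrier_vec n. \<forall>f \<in> vanishing_ideal n X.
     (\<Sum>i<n. eval_poly (partial_deriv i f) p * v $ i) = 0}"

text \<open>A point is singular if the dimension of the tangent space exceeds the local dimension of
  the variety. Every hypersurface in \<open>\<bbbA>\<^sup>n\<close> has dimension \<open>n - 1\<close> at each of its points (and
  \<open>n \<ge> 1\<close>, as its equation is not constant), so the definition is meant for
  hypersurfaces only.\<close>

definition hypersurface_singular_locus :: "nat \<Rightarrow> 'k::field vec set \<Rightarrow> 'k vec set" where
  "hypersurface_singular_locus n X = {p \<in> X.
     vectorspace.dim class_ring (module_vec TYPE('k) n \<lparr>carrier := tangent_space n X p\<rparr>) > n - 1}"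

text \<open>\<open>{p}\<close> is open in the topology that \<open>S\<close> inherits from the Zariski topology.\<close>

definition zariski_isolated :: "nat \<Rightarrow> 'k::comm_ring_1 vec set \<Rightarrow> 'k vec \<Rightarrow> bool" where
  "zariski_isolated n S p \<longleftrightarrow> (\<exists>Z. zariski_closed n Z \<and> S - Z = {p})"

definition has_isolated_singularity :: "nat \<Rightarrow> 'k::field vec set \<Rightarrow> bool" where
  "has_isolated_singularity n X \<longleftrightarrow>
     (\<exists>p \<in> hypersurface_singular_locus n X. zariski_isolated n (hypersurface_singular_locus n X) p)"

end

theory Submission
  imports Defs
begin

text \<open>
  Suppose that the action, extended trivially to \<open>\<bbbA>\<^sup>m = \<bbbA>\<^sup>n \<times> \<bbbA>\<^sup>d\<close>, is triangular in coordinates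
  \<open>y\<^sub>0, \<dots>, y\<^sub>m\<^sub>-\<^sub>1\<close>, and let \<open>y\<^sub>k\<close> be the first coordinate that it moves
  (\<open>triangular_action_first_moved_coordinate\<close>). The fixed points of the extension form the
  hypersurface \<open>X \<times> \<bbbA>\<^sup>d\<close>, and they are zeros of a nonzero polynomial in the invariant coordinates
  \<open>y\<^sub>0, \<dots>, y\<^sub>k\<^sub>-\<^sub>1\<close> alone. Hence the equation of \<open>X \<times> \<bbbA>\<^sup>d\<close>, too, contains only these coordinates
  (\<open>invariant_along_direction\<close>), so \<open>X \<times> \<bbbA>\<^sup>d\<close> and its singular locus are invariant under the
  translations in \<open>y\<^sub>k, \<dots>, y\<^sub>m\<^sub>-\<^sub>1\<close> (\<open>singular_at_transport\<close>). If \<open>p\<close> is an isolated singularity of \<open>X\<close>,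
  then a translate of a point of \<open>{p} \<times> \<bbbA>\<^sup>d\<close> stays in \<open>{p} \<times> \<bbbA>\<^sup>d\<close> (\<open>curve_through_isolated_point\<close>): the
  directions \<open>y\<^sub>k, \<dots>, y\<^sub>m\<^sub>-\<^sub>1\<close> are tangent to \<open>{p} \<times> \<bbbA>\<^sup>d\<close> there.

  It follows that the invariant functions \<open>y\<^sub>0, \<dots>, y\<^sub>k\<^sub>-\<^sub>1\<close>, restricted to \<open>\<bbbA>\<^sup>n\<close>, separate tangent vectors
  at \<open>p\<close>. Invariant functions cannot do this unless the action is trivial: the orbits near \<open>p\<close> would be
  points. In the proof this is made explicit by a map \<open>R : \<bbbA>\<^sup>n \<rightarrow> \<bbbA>\<^sup>n\<close> that factors through
  \<open>y\<^sub>0, \<dots>, y\<^sub>k\<^sub>-\<^sub>1\<close> and agrees with the identity to first order at \<open>p\<close>; the conclusion is drawn in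
  \<open>trivial_of_invariants\<close>. A trivial action has \<open>X = \<bbbA>\<^sup>n\<close>, which has no isolated singularity.

  Differentials are handled through the restriction of functions to polynomial curves, so that the
  chain rule becomes the composition of a curve with a map; the partial derivatives and the dimension
  of the tangent space in the definition of the singular locus are translated once, in
  \<open>hypersurface_singular_locus_iff\<close>.
\<close>

section \<open>Regular functions\<close>

text \<open>Polynomials enter only through the functions that they define, and most closure statements below
say that composing a polynomial with functions from some class stays in that class. One notion
serves the regular functions on affine space, the polynomial functions of one and of two
parameters, and the functions that have a gradient.\<close>

definition function_algebra :: "('a \<Rightarrow> 'k::comm_ring_1) set \<Rightarrow> bool" where
  "function_algebra S \<longleftrightarrow> (\<forall>k. (\<lambda>_. k) \<in> S) \<and>
     (\<forall>f \<in> S. \<forall>g \<in> S. (\<lambda>a. f a + g a) \<in> S \<and> (\<lambda>a. f a * g a) \<in> S)"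

lemma function_algebraD:
  assumes "function_algebra S"
  shows "(\<lambda>_. k) \<in> S" "f \<in> S \<Longrightarrow> g \<in> S \<Longrightarrow> (\<lambda>a. f a + g a) \<in> S"
    "f \<in> S \<Longrightarrow> g \<in> S \<Longrightarrow> (\<lambda>a. f a * g a) \<in> S"
  using assms unfolding function_algebra_def by auto

lemma function_algebra_sum:
  assumes "function_algebra S" "\<And>i. i \<in> I \<Longrightarrow> f i \<in> S"
  shows "(\<lambda>a. \<Sum>i\<in>I. f i a) \<in> S"
  using assms(2)
  by (induction I rule: infinite_finite_induct) (auto intro: function_algebraD[OF assms(1)])

lemma function_algebra_prod:
  assumes "function_algebra S" "\<And>i. i \<in> I \<Longrightarrow> f i \<in> S"
  shows "(\<lambda>a. \<Prod>i\<in>I. f i a) \<in> S"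
  using assms(2)
  by (induction I rule: infinite_finite_induct) (auto intro: function_algebraD[OF assms(1)])

lemma function_algebra_power:
  assumes "function_algebra S" "f \<in> S"
  shows "(\<lambda>a. f a ^ e) \<in> S"
  using assms(2) by (induction e) (auto intro: function_algebraD[OF assms(1)])

lemma function_algebra_diff:
  assumes "function_algebra S" "f \<in> S" "g \<in> S"
  shows "(\<lambda>a. f a - g a) \<in> S"
  using function_algebraD(2)[OF assms(1,2) function_algebraD(3)[OF assms(1) function_algebraD(1)[OF assms(1), of "-1"] assms(3)]]
  by simp

lemma eval_poly_in_function_algebra:
  assumes S: "function_algebra S" and P: "P \<in> poly_ring n"
    and c: "\<And>i. i < n \<Longrightarrow> (\<lambda>a. c a $ i) \<in> S"
  shows "(\<lambda>a. eval_poly P (c a)) \<in> S"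
proof -
  have "(\<lambda>a. c a $ i) \<in> S" if "m \<in> Poly_Mapping.keys P" "i \<in> Poly_Mapping.keys m" for m i
    using P that c unfolding poly_ring_def by blast
  then show ?thesis
    unfolding eval_poly_def
    by (intro function_algebra_sum[OF S] function_algebraD(3)[OF S] function_algebraD(1)[OF S]
        function_algebra_prod[OF S] function_algebra_power[OF S])
qed

lemma eval_poly_cong:
  assumes "P \<in> poly_ring n" "\<And>i. i < n \<Longrightarrow> x $ i = y $ i"
  shows "eval_poly P x = eval_poly P y"
  using assms unfolding eval_poly_def poly_ring_def
  by (intro sum.cong prod.cong arg_cong2[where f="(*)"] arg_cong2[where f="(^)"]) auto

definition monom_value :: "(nat \<Rightarrow>\<^sub>0 nat) \<Rightarrow> 'k::comm_ring_1 vec \<Rightarrow> 'k" where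
  "monom_value m x = (\<Prod>i \<in> Poly_Mapping.keys m. (x $ i) ^ Poly_Mapping.lookup m i)"

text \<open>Products over a common index set make the exponents of different monomials comparable.\<close>

lemma monom_value_superset:
  assumes "finite I" "Poly_Mapping.keys m \<subseteq> I"
  shows "monom_value m x = (\<Prod>i\<in>I. (x $ i) ^ Poly_Mapping.lookup m i)"
  unfolding monom_value_def using assms
  by (intro prod.mono_neutral_left) (auto simp: in_keys_iff)

lemma monom_value_add: "monom_value (m + m') x = monom_value m x * monom_value m' x"
proof -
  let ?I = "Poly_Mapping.keys m \<union> Poly_Mapping.keys m'"
  have "monom_value (m + m') x = (\<Prod>i\<in>?I. (x $ i) ^ Poly_Mapping.lookup (m + m') i)"
    by (rule monom_value_superset) (simp_all add: keys_add)
  then show ?thesis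
    by (simp add: lookup_add power_add prod.distrib monom_value_superset[of ?I])
qed

lemma eval_poly_monom_value:
  "eval_poly P x = (\<Sum>m \<in> Poly_Mapping.keys P. Poly_Mapping.lookup P m * monom_value m x)"
  by (simp add: eval_poly_def monom_value_def)

lemma eval_poly_add: "eval_poly (P + Q) x = eval_poly P x + eval_poly Q x"
  unfolding eval_poly_monom_value
  by (rule setsum_keys_plus_distrib) (auto simp: algebra_simps)

lemma eval_poly_zero: "eval_poly 0 x = 0"
  by (simp add: eval_poly_def)

lemma eval_poly_sum: "eval_poly (\<Sum>i\<in>I. P i) x = (\<Sum>i\<in>I. eval_poly (P i) x)"
  by (induction I rule: infinite_finite_induct) (auto simp: eval_poly_add eval_poly_zero)

lemma eval_poly_single: "eval_poly (Poly_Mapping.single m a) x = a * monom_value m x"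
  by (simp add: eval_poly_monom_value)

lemma sum_of_monomials:
  "P = (\<Sum>m \<in> Poly_Mapping.keys P. Poly_Mapping.single m (Poly_Mapping.lookup P m))"
proof (rule poly_mapping_eqI)
  fix k
  have "Poly_Mapping.lookup P k =
      (\<Sum>m \<in> Poly_Mapping.keys P. if m = k then Poly_Mapping.lookup P m else 0)"
    by (simp add: sum.delta in_keys_iff)
  then show "Poly_Mapping.lookup P k = Poly_Mapping.lookup
      (\<Sum>m \<in> Poly_Mapping.keys P. Poly_Mapping.single m (Poly_Mapping.lookup P m)) k"
    by (simp add: lookup_sum lookup_single when_def)
qed

lemma eval_poly_mult: "eval_poly (P * Q) x = eval_poly P x * eval_poly Q x"
proof -
  let ?t = "\<lambda>P m. Poly_Mapping.single m (Poly_Mapping.lookup P m)"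
  have "P * Q = (\<Sum>m \<in> Poly_Mapping.keys P. ?t P m) * (\<Sum>m' \<in> Poly_Mapping.keys Q. ?t Q m')"
    using sum_of_monomials[of P] sum_of_monomials[of Q] by simp
  also have "\<dots> = (\<Sum>m \<in> Poly_Mapping.keys P. \<Sum>m' \<in> Poly_Mapping.keys Q.
      Poly_Mapping.single (m + m') (Poly_Mapping.lookup P m * Poly_Mapping.lookup Q m'))"
    by (simp add: sum_product mult_single)
  finally show ?thesis
    by (simp add: eval_poly_sum eval_poly_single eval_poly_monom_value[of P]
        eval_poly_monom_value[of Q] sum_product monom_value_add algebra_simps)
qed

lemma poly_ring_add: "P \<in> poly_ring n \<Longrightarrow> Q \<in> poly_ring n \<Longrightarrow> P + Q \<in> poly_ring n"
  using keys_add[of P Q] unfolding poly_ring_def by blast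

lemma poly_ring_mult:
  assumes "P \<in> poly_ring n" "Q \<in> poly_ring n"
  shows "P * Q \<in> poly_ring n"
proof -
  have "Poly_Mapping.keys m \<subseteq> {..<n}" if m: "m \<in> Poly_Mapping.keys (P * Q)" for m
  proof -
    obtain a b where "m = a + b" "a \<in> Poly_Mapping.keys P" "b \<in> Poly_Mapping.keys Q"
      using m keys_mult[of P Q] by auto
    then show ?thesis
      using assms keys_add[of a b] unfolding poly_ring_def by blast
  qed
  then show ?thesis unfolding poly_ring_def by blast
qed

lemma function_algebra_regular: "function_algebra {f. regular_function n f}"
  unfolding function_algebra_def
proof (intro conjI allI ballI)
  fix k :: 'a
  show "(\<lambda>_. k) \<in> {f. regular_function n f}"
    unfolding regular_function_def mem_Collect_eq
    by (rule bexI[of _ "Poly_Mapping.single 0 k"])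
      (auto simp: eval_poly_single monom_value_def poly_ring_def)
next
  fix f g :: "'a vec \<Rightarrow> 'a" assume "f \<in> {f. regular_function n f}" "g \<in> {f. regular_function n f}"
  then obtain P Q where PQ: "P \<in> poly_ring n" "\<forall>x\<in>carrier_vec n. f x = eval_poly P x"
      "Q \<in> poly_ring n" "\<forall>x\<in>carrier_vec n. g x = eval_poly Q x"
    unfolding regular_function_def by blast
  show "(\<lambda>a. f a + g a) \<in> {f. regular_function n f}"
    unfolding regular_function_def mem_Collect_eq
    using PQ by (intro bexI[of _ "P + Q"] poly_ring_add) (auto simp: eval_poly_add)
  show "(\<lambda>a. f a * g a) \<in> {f. regular_function n f}"
    unfolding regular_function_def mem_Collect_eq
    using PQ by (intro bexI[of _ "P * Q"] poly_ring_mult) (auto simp: eval_poly_mult)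
qed

lemma regular_function_coordinate: "i < n \<Longrightarrow> regular_function n (\<lambda>x. x $ i)"
  unfolding regular_function_def
  by (rule bexI[of _ "Poly_Mapping.single (Poly_Mapping.single i 1) 1"])
    (auto simp: eval_poly_single monom_value_def poly_ring_def)

lemma regular_function_eval_poly: "P \<in> poly_ring n \<Longrightarrow> regular_function n (eval_poly P)"
  unfolding regular_function_def by auto

lemma poly_ring_mono: "n \<le> n' \<Longrightarrow> P \<in> poly_ring n \<Longrightarrow> P \<in> poly_ring n'"
  unfolding poly_ring_def by fastforce

lemma regular_function_cong:
  "regular_function n f \<Longrightarrow> (\<And>x. x \<in> carrier_vec n \<Longrightarrow> f x = g x) \<Longrightarrow> regular_function n g"
  unfolding regular_function_def by auto

lemma regular_function_compose:
  assumes "regular_function n f" "regular_map m n F"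
  shows "regular_function m (\<lambda>x. f (F x))"
proof -
  obtain P where P: "P \<in> poly_ring n" "\<And>x. x \<in> carrier_vec n \<Longrightarrow> f x = eval_poly P x"
    using assms(1) unfolding regular_function_def by auto
  have "(\<lambda>x. eval_poly P (F x)) \<in> {f. regular_function m f}"
    using assms(2) unfolding regular_map_def
    by (intro eval_poly_in_function_algebra[OF function_algebra_regular P(1)]) simp
  then show ?thesis
    using assms(2) P(2) unfolding regular_map_def
    by - (rule regular_function_cong[where f="\<lambda>x. eval_poly P (F x)"], auto simp: Pi_iff)
qed

lemma regular_map_compose:
  assumes "regular_map n l G" "regular_map m n F"
  shows "regular_map m l (\<lambda>x. G (F x))"
proof -
  have "regular_function m (\<lambda>x. G (F x) $ i)" if "i < l" for i
    using assms(1) that unfolding regular_map_def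
    by (intro regular_function_compose[where f="\<lambda>y. G y $ i", OF _ assms(2)]) simp
  then show ?thesis
    using assms unfolding regular_map_def by (auto simp: Pi_iff)
qed

lemma regular_map_cong:
  "regular_map m n F \<Longrightarrow> (\<And>x. x \<in> carrier_vec m \<Longrightarrow> F x = G x) \<Longrightarrow> regular_map m n G"
  unfolding regular_map_def regular_function_def by (simp add: Pi_iff)

section \<open>Polynomial curves and critical points\<close>

definition poly_curve :: "nat \<Rightarrow> ('k::comm_ring_1 \<Rightarrow> 'k vec) \<Rightarrow> bool" where
  "poly_curve m c \<longleftrightarrow> (\<forall>t. c t \<in> carrier_vec m) \<and> (\<forall>i<m. (\<lambda>t. c t $ i) \<in> range poly)"

lemma function_algebra_poly: "function_algebra (range (poly :: 'k::comm_ring_1 poly \<Rightarrow> _))"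
proof -
  have "(\<lambda>_. k) = poly [:k:]" "(\<lambda>a. poly p a + poly q a) = poly (p + q)"
    "(\<lambda>a. poly p a * poly q a) = poly (p * q)" for k and p q :: "'k poly"
    by auto
  then show ?thesis unfolding function_algebra_def by auto
qed

lemma regular_function_curve:
  assumes "regular_function m F" "poly_curve m c"
  obtains r where "\<And>t. F (c t) = poly r t"
proof -
  obtain P where P: "P \<in> poly_ring m" "\<And>x. x \<in> carrier_vec m \<Longrightarrow> F x = eval_poly P x"
    using assms(1) unfolding regular_function_def by auto
  have "(\<lambda>t. eval_poly P (c t)) \<in> range poly"
    using assms(2) unfolding poly_curve_def
    by (intro eval_poly_in_function_algebra[OF function_algebra_poly P(1)]) simp
  then show ?thesis
    using that P(2) assms(2) unfolding poly_curve_def by (metis imageE)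
qed

lemma regular_map_curve:
  assumes "regular_map m n T" "poly_curve m c"
  shows "poly_curve n (\<lambda>t. T (c t))"
  unfolding poly_curve_def
proof (intro conjI allI impI)
  show "T (c t) \<in> carrier_vec n" for t
    using assms unfolding regular_map_def poly_curve_def by auto
  fix i assume "i < n"
  then have "regular_function m (\<lambda>x. T x $ i)"
    using assms(1) unfolding regular_map_def by simp
  then obtain r where "\<And>t. T (c t) $ i = poly r t"
    using regular_function_curve[OF _ assms(2)] by blast
  then show "(\<lambda>t. T (c t) $ i) \<in> range poly" by (intro image_eqI[of _ _ r]) auto
qed

lemma poly_curve_line:
  assumes "q \<in> carrier_vec m" "v \<in> carrier_vec m"
  shows "poly_curve m (\<lambda>t. q + t \<cdot>\<^sub>v v)"
  unfolding poly_curve_def using assms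
  by (auto intro!: image_eqI[of _ _ "[:q $ i, v $ i:]" for i])

lemma poly_curve_const: "q \<in> carrier_vec m \<Longrightarrow> poly_curve m (\<lambda>_. q)"
  unfolding poly_curve_def by (auto intro!: image_eqI[of _ _ "[:q $ i:]" for i])

lemma poly_curve_coords:
  assumes "poly_curve m c"
  obtains C where "\<And>i t. i < m \<Longrightarrow> c t $ i = poly (C i) t"
proof -
  have "\<forall>i. \<exists>C. i < m \<longrightarrow> (\<forall>t. c t $ i = poly C t)"
    using assms unfolding poly_curve_def by (metis imageE)
  then show ?thesis using that by metis
qed

text \<open>This is Hadamard's lemma read as a definition: along any two polynomial curves through \<open>q\<close>, the
difference of the values of \<open>F\<close> is a combination of the differences of the coordinates whose
coefficients \<open>M i\<close> specialise to \<open>g i\<close> at \<open>q\<close>. Taking a constant second curve gives the chain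
rule; comparing two moving curves gives an estimate for the order to which \<open>F\<close> separates them.\<close>

definition gradient_at ::
    "nat \<Rightarrow> ('k::comm_ring_1 vec \<Rightarrow> 'k) \<Rightarrow> 'k vec \<Rightarrow> (nat \<Rightarrow> 'k) \<Rightarrow> bool" where
  "gradient_at m F q g \<longleftrightarrow> (\<forall>c\<^sub>1 c\<^sub>2. poly_curve m c\<^sub>1 \<longrightarrow> poly_curve m c\<^sub>2 \<longrightarrow> c\<^sub>1 0 = q \<longrightarrow> c\<^sub>2 0 = q \<longrightarrow>
     (\<exists>M. (\<forall>i<m. poly (M i) 0 = g i) \<and>
       (\<forall>t. F (c\<^sub>1 t) - F (c\<^sub>2 t) = (\<Sum>i<m. poly (M i) t * (c\<^sub>1 t $ i - c\<^sub>2 t $ i)))))"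

text \<open>Functions with this property form an algebra, by the product rule
\<open>F\<^sub>1 G\<^sub>1 - F\<^sub>2 G\<^sub>2 = F\<^sub>1 (G\<^sub>1 - G\<^sub>2) + (F\<^sub>1 - F\<^sub>2) G\<^sub>2\<close>, and this algebra contains the coordinates.\<close>

lemma regular_function_gradient:
  fixes F :: "'k::comm_ring_1 vec \<Rightarrow> 'k"
  assumes F: "regular_function m F"
  shows "\<exists>g. gradient_at m F q g"
proof -
  define Q where "Q F g c\<^sub>1 c\<^sub>2 M \<longleftrightarrow> (\<forall>i<m. poly (M i) 0 = g i) \<and>
      (\<forall>t. F (c\<^sub>1 t) - F (c\<^sub>2 t) = (\<Sum>i<m. poly (M i) t * (c\<^sub>1 t $ i - c\<^sub>2 t $ i)))"
    for F :: "'k vec \<Rightarrow> 'k" and g :: "nat \<Rightarrow> 'k" and c\<^sub>1 c\<^sub>2 M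
  define curves where "curves = {(c\<^sub>1, c\<^sub>2). poly_curve m c\<^sub>1 \<and> poly_curve m c\<^sub>2 \<and> c\<^sub>1 0 = q \<and> c\<^sub>2 0 = q}"
  define S where "S = {F :: 'k vec \<Rightarrow> 'k. (\<forall>c. poly_curve m c \<longrightarrow> (\<lambda>t. F (c t)) \<in> range poly) \<and>
    (\<exists>g. \<forall>(c\<^sub>1, c\<^sub>2) \<in> curves. \<exists>M. Q F g c\<^sub>1 c\<^sub>2 M)}"
  have S_I: "F \<in> S" if "\<And>c. poly_curve m c \<Longrightarrow> (\<lambda>t. F (c t)) \<in> range poly"
    and "\<And>c\<^sub>1 c\<^sub>2. (c\<^sub>1, c\<^sub>2) \<in> curves \<Longrightarrow> \<exists>M. Q F g c\<^sub>1 c\<^sub>2 M" for F g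
    unfolding S_def mem_Collect_eq using that by (intro conjI allI impI exI[of _ g]) blast+
  have S: "function_algebra S"
    unfolding function_algebra_def
  proof (intro conjI allI ballI)
    fix k :: 'k
    have "\<exists>M. Q (\<lambda>_. k) (\<lambda>_. 0) c\<^sub>1 c\<^sub>2 M" for c\<^sub>1 c\<^sub>2
      by (rule exI[of _ "\<lambda>_. 0"]) (simp add: Q_def)
    then show "(\<lambda>_. k) \<in> S"
      by (intro S_I function_algebraD(1)[OF function_algebra_poly])
  next
    fix f h assume fh: "f \<in> S" "h \<in> S"
    obtain gf gh where gf: "\<And>c\<^sub>1 c\<^sub>2. (c\<^sub>1, c\<^sub>2) \<in> curves \<Longrightarrow> \<exists>M. Q f gf c\<^sub>1 c\<^sub>2 M"
      and gh: "\<And>c\<^sub>1 c\<^sub>2. (c\<^sub>1, c\<^sub>2) \<in> curves \<Longrightarrow> \<exists>M. Q h gh c\<^sub>1 c\<^sub>2 M"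
      using fh unfolding S_def by blast
    have pf: "(\<lambda>t. f (c t)) \<in> range poly" and ph: "(\<lambda>t. h (c t)) \<in> range poly"
      if "poly_curve m c" for c
      using fh that unfolding S_def by auto
    have "\<exists>M. Q (\<lambda>x. f x + h x) (\<lambda>i. gf i + gh i) c\<^sub>1 c\<^sub>2 M" if c: "(c\<^sub>1, c\<^sub>2) \<in> curves" for c\<^sub>1 c\<^sub>2
    proof -
      obtain Mf Mh where "Q f gf c\<^sub>1 c\<^sub>2 Mf" "Q h gh c\<^sub>1 c\<^sub>2 Mh" using gf gh c by blast
      then have "Q (\<lambda>x. f x + h x) (\<lambda>i. gf i + gh i) c\<^sub>1 c\<^sub>2 (\<lambda>i. Mf i + Mh i)"
        unfolding Q_def by (simp add: add_diff_add distrib_right sum.distrib)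
      then show ?thesis by blast
    qed
    then show "(\<lambda>x. f x + h x) \<in> S"
      by (rule S_I[rotated]) (auto intro!: function_algebraD(2)[OF function_algebra_poly] pf ph)
    have "\<exists>M. Q (\<lambda>x. f x * h x) (\<lambda>i. f q * gh i + gf i * h q) c\<^sub>1 c\<^sub>2 M"
      if c: "(c\<^sub>1, c\<^sub>2) \<in> curves" for c\<^sub>1 c\<^sub>2
    proof -
      obtain Mf Mh where M: "Q f gf c\<^sub>1 c\<^sub>2 Mf" "Q h gh c\<^sub>1 c\<^sub>2 Mh" using gf gh c by blast
      have "poly_curve m c\<^sub>1" "poly_curve m c\<^sub>2" and c0: "c\<^sub>1 0 = q" "c\<^sub>2 0 = q"
        using c unfolding curves_def by auto
      then obtain pf' ph' where p: "\<And>t. f (c\<^sub>1 t) = poly pf' t" "\<And>t. h (c\<^sub>2 t) = poly ph' t"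
        using pf ph by (metis imageE)
      have "f (c\<^sub>1 t) * h (c\<^sub>1 t) - f (c\<^sub>2 t) * h (c\<^sub>2 t) =
          (\<Sum>i<m. poly (pf' * Mh i + Mf i * ph') t * (c\<^sub>1 t $ i - c\<^sub>2 t $ i))" for t
      proof -
        have "f (c\<^sub>1 t) * h (c\<^sub>1 t) - f (c\<^sub>2 t) * h (c\<^sub>2 t) =
            f (c\<^sub>1 t) * (h (c\<^sub>1 t) - h (c\<^sub>2 t)) + (f (c\<^sub>1 t) - f (c\<^sub>2 t)) * h (c\<^sub>2 t)"
          by (simp add: algebra_simps)
        also have "\<dots> = poly pf' t * (\<Sum>i<m. poly (Mh i) t * (c\<^sub>1 t $ i - c\<^sub>2 t $ i)) +
            (\<Sum>i<m. poly (Mf i) t * (c\<^sub>1 t $ i - c\<^sub>2 t $ i)) * poly ph' t"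
          using M unfolding Q_def p by simp
        also have "\<dots> = (\<Sum>i<m. poly (pf' * Mh i + Mf i * ph') t * (c\<^sub>1 t $ i - c\<^sub>2 t $ i))"
          by (simp add: sum_distrib_left sum_distrib_right sum.distrib[symmetric] algebra_simps)
        finally show ?thesis .
      qed
      moreover have "poly (pf' * Mh i + Mf i * ph') 0 = f q * gh i + gf i * h q" if "i < m" for i
        using M that p[of 0] c0 unfolding Q_def by simp
      ultimately show ?thesis unfolding Q_def by (intro exI[of _ "\<lambda>i. pf' * Mh i + Mf i * ph'"]) blast
    qed
    then show "(\<lambda>x. f x * h x) \<in> S"
      by (rule S_I[rotated]) (auto intro!: function_algebraD(3)[OF function_algebra_poly] pf ph)
  qed
  have coord: "(\<lambda>x. x $ i) \<in> S" if i: "i < m" for i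
  proof -
    have "Q (\<lambda>x. x $ i) (\<lambda>j. if j = i then 1 else 0) c\<^sub>1 c\<^sub>2 (\<lambda>j. if j = i then 1 else 0)" for c\<^sub>1 c\<^sub>2
    proof -
      have "c\<^sub>1 t $ i - c\<^sub>2 t $ i =
          (\<Sum>j<m. poly (if j = i then 1 else 0) t * (c\<^sub>1 t $ j - c\<^sub>2 t $ j))" for t
      proof -
        have "(\<Sum>j<m. poly (if j = i then 1 else 0) t * (c\<^sub>1 t $ j - c\<^sub>2 t $ j)) =
            (\<Sum>j<m. if j = i then c\<^sub>1 t $ j - c\<^sub>2 t $ j else 0)"
          by (intro sum.cong) auto
        then show ?thesis using i by simp
      qed
      then show ?thesis unfolding Q_def by simp
    qed
    then show ?thesis
      using i by (intro S_I[where g="\<lambda>j. if j = i then 1 else 0"]) (auto simp: poly_curve_def)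
  qed
  obtain P where P: "P \<in> poly_ring m" "\<And>x. x \<in> carrier_vec m \<Longrightarrow> F x = eval_poly P x"
    using F unfolding regular_function_def by auto
  have "eval_poly P \<in> S"
    using eval_poly_in_function_algebra[OF S P(1), of "\<lambda>x. x"] coord by simp
  then obtain g where g: "\<And>c\<^sub>1 c\<^sub>2. (c\<^sub>1, c\<^sub>2) \<in> curves \<Longrightarrow> \<exists>M. Q (eval_poly P) g c\<^sub>1 c\<^sub>2 M"
    unfolding S_def by blast
  have "gradient_at m F q g"
    unfolding gradient_at_def
  proof (intro allI impI)
    fix c\<^sub>1 c\<^sub>2 assume c: "poly_curve m c\<^sub>1" "poly_curve m c\<^sub>2" "c\<^sub>1 0 = q" "c\<^sub>2 0 = q"
    then obtain M where "Q (eval_poly P) g c\<^sub>1 c\<^sub>2 M" using g unfolding curves_def by blast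
    then show "\<exists>M. (\<forall>i<m. poly (M i) 0 = g i) \<and>
      (\<forall>t. F (c\<^sub>1 t) - F (c\<^sub>2 t) = (\<Sum>i<m. poly (M i) t * (c\<^sub>1 t $ i - c\<^sub>2 t $ i)))"
      using c P(2) unfolding Q_def poly_curve_def by (intro exI[of _ M]) auto
  qed
  then show ?thesis by blast
qed

text \<open>The vanishing of the differential, stated through curves. In this form it is evidently stable under
pullback along regular maps, which replaces all computations with Jacobian matrices.\<close>

definition critical :: "nat \<Rightarrow> ('k::comm_ring_1 vec \<Rightarrow> 'k) \<Rightarrow> 'k vec \<Rightarrow> bool" where
  "critical m F q \<longleftrightarrow> (\<forall>c r. poly_curve m c \<longrightarrow> c 0 = q \<longrightarrow> (\<forall>t. F (c t) = poly r t) \<longrightarrow> coeff r 1 = 0)"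

lemma critical_pullback:
  assumes "critical n F (T q)" "regular_map m n T"
  shows "critical m (\<lambda>x. F (T x)) q"
  using assms regular_map_curve[OF assms(2)] unfolding critical_def by blast

lemma critical_cong:
  assumes "critical m F q" "\<And>x. x \<in> carrier_vec m \<Longrightarrow> F x = G x"
  shows "critical m G q"
  using assms unfolding critical_def poly_curve_def by metis

lemma coeff_1_mult: "coeff (p * q) 1 = coeff p 0 * coeff q 1 + coeff p 1 * coeff q 0"
  by (simp add: coeff_mult)

lemma gradient_at_curve:
  fixes F :: "'k::field_char_0 vec \<Rightarrow> 'k"
  assumes g: "gradient_at m F q g" and c: "poly_curve m c" and c0: "c 0 = q"
    and C: "\<And>i t. i < m \<Longrightarrow> c t $ i = poly (C i) t"
    and r: "\<And>t. F (c t) = poly r t"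
  shows "coeff r 1 = (\<Sum>i<m. g i * coeff (C i) 1)"
proof -
  have "q \<in> carrier_vec m" using c c0 unfolding poly_curve_def by metis
  from g[unfolded gradient_at_def, rule_format, OF c poly_curve_const[OF this] c0 refl]
  obtain M where M: "\<forall>i<m. poly (M i) 0 = g i"
    and diff: "\<forall>t. F (c t) - F q = (\<Sum>i<m. poly (M i) t * (c t $ i - q $ i))" by blast
  have "r - [:F q:] = (\<Sum>i<m. M i * (C i - [:q $ i:]))"
    using diff by (auto simp: r C poly_sum fun_eq_iff poly_eq_poly_eq_iff[symmetric] intro!: sum.cong)
  then have "coeff (r - [:F q:]) 1 = (\<Sum>i<m. coeff (M i * (C i - [:q $ i:])) 1)"
    by (simp add: coeff_sum)
  also have "\<dots> = (\<Sum>i<m. g i * coeff (C i) 1)"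
  proof (intro sum.cong refl)
    fix i assume "i \<in> {..<m}"
    then have "coeff (C i) 0 = q $ i" "coeff (M i) 0 = g i"
      using C[of i 0] M c0 by (auto simp: poly_0_coeff_0)
    then show "coeff (M i * (C i - [:q $ i:])) 1 = g i * coeff (C i) 1"
      unfolding coeff_1_mult by simp
  qed
  finally show ?thesis by simp
qed

lemma gradient_at_axis:
  fixes F :: "'k::field_char_0 vec \<Rightarrow> 'k"
  assumes g: "gradient_at m F q g" and q: "q \<in> carrier_vec m" and i: "i < m"
    and r: "\<And>t. F (q + t \<cdot>\<^sub>v unit_vec m i) = poly r t"
  shows "coeff r 1 = g i"
proof -
  let ?C = "\<lambda>j. [:q $ j, if j = i then 1 else 0:]"
  have "coeff r 1 = (\<Sum>j<m. g j * coeff (?C j) 1)"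
    using q i by (intro gradient_at_curve[OF g poly_curve_line[of q m "unit_vec m i"] _ _ r]) auto
  also have "\<dots> = (\<Sum>j<m. if j = i then g j else 0)"
    by (intro sum.cong) auto
  finally show ?thesis using i by simp
qed

text \<open>By the chain rule, the lines parallel to the coordinate axes suffice.\<close>

lemma critical_axes:
  fixes F :: "'k::field_char_0 vec \<Rightarrow> 'k"
  assumes F: "regular_function m F" and q: "q \<in> carrier_vec m"
    and axes: "\<And>i. i < m \<Longrightarrow> \<exists>r. (\<forall>t. F (q + t \<cdot>\<^sub>v unit_vec m i) = poly r t) \<and> coeff r 1 = 0"
  shows "critical m F q"
proof -
  obtain g where g: "gradient_at m F q g" using regular_function_gradient[OF F] by blast
  have g0: "g i = 0" if "i < m" for i
    using axes[OF that] gradient_at_axis[OF g q that] by metis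
  show ?thesis unfolding critical_def
  proof (intro allI impI)
    fix c r assume c: "poly_curve m c" "c 0 = q" "\<forall>t. F (c t) = poly r t"
    obtain C where "\<And>i t. i < m \<Longrightarrow> c t $ i = poly (C i) t" using poly_curve_coords[OF c(1)] by metis
    then have "coeff r 1 = (\<Sum>i<m. g i * coeff (C i) 1)"
      using gradient_at_curve[OF g c(1,2)] c(3) by blast
    then show "coeff r 1 = 0" using g0 by simp
  qed
qed

lemma critical_gradient:
  fixes F :: "'k::field_char_0 vec \<Rightarrow> 'k"
  assumes "critical m F q" "gradient_at m F q g" "regular_function m F" "q \<in> carrier_vec m" "i < m"
  shows "g i = 0"
proof -
  let ?c = "\<lambda>t. q + t \<cdot>\<^sub>v unit_vec m i"
  have curve: "poly_curve m ?c" "?c 0 = q" using assms(4) by (auto intro: poly_curve_line)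
  obtain r where r: "\<And>t. F (?c t) = poly r t" using regular_function_curve[OF assms(3) curve(1)] by metis
  then have "coeff r 1 = 0" using assms(1) curve unfolding critical_def by blast
  then show ?thesis using gradient_at_axis[OF assms(2,4,5) r] by simp
qed

text \<open>At a critical point all coefficients \<open>M i\<close> of Hadamard's lemma vanish at parameter \<open>0\<close>, which gains
one power of the parameter.\<close>

lemma critical_difference_order:
  fixes F :: "'k::field_char_0 vec \<Rightarrow> 'k"
  assumes F: "regular_function m F" and crit: "critical m F q"
    and c: "poly_curve m c\<^sub>1" "poly_curve m c\<^sub>2" "c\<^sub>1 0 = q" "c\<^sub>2 0 = q"
    and D: "\<And>i t. i < m \<Longrightarrow> c\<^sub>1 t $ i - c\<^sub>2 t $ i = poly (D i) t"
    and dvd: "\<And>i. i < m \<Longrightarrow> [:0, 1:] ^ r dvd D i"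
    and E: "\<And>t. F (c\<^sub>1 t) - F (c\<^sub>2 t) = poly E t"
  shows "[:0, 1:] ^ Suc r dvd E"
proof -
  have q: "q \<in> carrier_vec m" using c unfolding poly_curve_def by metis
  obtain g where g: "gradient_at m F q g" using regular_function_gradient[OF F] by blast
  then obtain M where M: "\<forall>i<m. poly (M i) 0 = g i"
    "\<forall>t. F (c\<^sub>1 t) - F (c\<^sub>2 t) = (\<Sum>i<m. poly (M i) t * (c\<^sub>1 t $ i - c\<^sub>2 t $ i))"
    using c unfolding gradient_at_def by blast
  have "E = (\<Sum>i<m. M i * D i)"
    using M(2) by (auto simp: E D poly_eq_poly_eq_iff[symmetric] fun_eq_iff poly_sum)
  moreover have "[:0, 1:] * [:0, 1:] ^ r dvd M i * D i" if "i < m" for i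
    using M(1) critical_gradient[OF crit g F q that] dvd[OF that] that poly_eq_0_iff_dvd[of "M i" 0]
    by (intro mult_dvd_mono) auto
  ultimately show ?thesis by (auto intro: dvd_sum)
qed

text \<open>If \<open>R\<close> is invariant under \<open>T\<close> and agrees with the identity to first order at a fixed point \<open>p\<close> of \<open>T\<close>, then
\<open>R\<close> is formally injective at \<open>p\<close>, so \<open>T\<close> must be the identity. Concretely, restrict to a line through
\<open>p\<close> and put \<open>E = R - id\<close>. Invariance gives \<open>T - id = E - E \<circ> T\<close>, and \<open>E\<close> is critical at \<open>p\<close>, so
whenever \<open>t\<^sup>r\<close> divides all coordinates of \<open>T - id\<close> on the line, so does \<open>t\<^sup>r\<^sup>+\<^sup>1\<close>.\<close>

lemma trivial_of_invariants:
  fixes T R :: "'k::field_char_0 vec \<Rightarrow> 'k vec"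
  assumes T: "regular_map n n T" "T p = p" and p: "p \<in> carrier_vec n"
    and R: "regular_map n n R" "\<And>x. x \<in> carrier_vec n \<Longrightarrow> R (T x) = R x"
    and crit: "\<And>l. l < n \<Longrightarrow> critical n (\<lambda>x. R x $ l - x $ l) p"
    and x: "x \<in> carrier_vec n"
  shows "T x = x"
proof -
  define c where "c t = p + t \<cdot>\<^sub>v (x - p)" for t
  have c: "poly_curve n c" "c 0 = p" "c 1 = x"
    using p x unfolding c_def by (auto intro: poly_curve_line)
  have Tc: "poly_curve n (\<lambda>t. T (c t))" by (rule regular_map_curve[OF T(1) c(1)])
  obtain C where C: "\<And>i t. i < n \<Longrightarrow> c t $ i = poly (C i) t" using poly_curve_coords[OF c(1)] by metis
  obtain C' where C': "\<And>i t. i < n \<Longrightarrow> T (c t) $ i = poly (C' i) t" using poly_curve_coords[OF Tc] by metis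
  have car: "c t \<in> carrier_vec n" for t using c(1) unfolding poly_curve_def by simp
  have "\<forall>i<n. [:0, 1:] ^ r dvd C' i - C i" for r
  proof (induction r)
    case (Suc r)
    show ?case
    proof (intro allI impI)
      fix l assume l: "l < n"
      have reg: "regular_function n (\<lambda>x. R x $ l - x $ l)"
        using function_algebra_diff[OF function_algebra_regular] R(1) regular_function_coordinate l
        unfolding regular_map_def by fast
      have "[:0, 1:] ^ Suc r dvd - (C' l - C l)"
      proof (rule critical_difference_order[OF reg crit[OF l] Tc c(1) _ c(2)])
        show "T (c 0) = p" using T(2) c(2) by simp
        show "T (c t) $ i - c t $ i = poly (C' i - C i) t" if "i < n" for i t
          using that C C' by simp
        show "[:0, 1:] ^ r dvd C' i - C i" if "i < n" for i using Suc that by simp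
        show "R (T (c t)) $ l - T (c t) $ l - (R (c t) $ l - c t $ l) = poly (- (C' l - C l)) t" for t
          using R(2)[OF car] C C' l by simp
      qed
      then show "[:0, 1:] ^ Suc r dvd C' l - C l" by (simp only: dvd_minus_iff)
    qed
  qed simp
  then have zero: "C' i - C i = 0" if i: "i < n" for i
  proof (rule_tac ccontr)
    assume nz: "C' i - C i \<noteq> 0"
    have "[:0, 1:] ^ Suc (Polynomial.degree (C' i - C i)) dvd C' i - C i"
      using \<open>\<And>r. \<forall>i<n. [:0, 1:] ^ r dvd C' i - C i\<close> i by blast
    from dvd_imp_degree_le[OF this nz] show False
      by (simp add: degree_power_eq)
  qed
  show ?thesis
  proof (rule eq_vecI)
    fix i assume "i < dim_vec x"
    then have i: "i < n" using x by simp
    have "T (c 1) $ i = c 1 $ i" using C[OF i] C'[OF i] zero[OF i] by simp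
    then show "T x $ i = x $ i" using c(3) by simp
  qed (use T(1) x in \<open>auto simp: regular_map_def Pi_iff\<close>)
qed

section \<open>Functions without zeros off a cylinder\<close>

text \<open>A function of two parameters \<open>u\<close> and \<open>t\<close> is encoded as a polynomial in \<open>t\<close> whose coefficients are
polynomials in \<open>u\<close>; it may be evaluated in either order.\<close>

lemma poly_poly_slice:
  fixes P :: "'k::comm_ring_1 poly poly"
  shows "poly (poly P [:t:]) u = poly (map_poly (\<lambda>c. poly c u) P) t"
  by (induction P) (simp_all add: map_poly_pCons)

lemma function_algebra_bivariate:
  "function_algebra (range (\<lambda>(P :: 'k::comm_ring_1 poly poly) (u, t). poly (poly P [:t:]) u))"
proof -
  let ?e = "\<lambda>(P :: 'k poly poly) (u, t). poly (poly P [:t:]) u"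
  have "(\<lambda>_. k) = ?e [:[:k:]:]" for k by auto
  then have "(\<lambda>_. k) \<in> range ?e" for k by (rule range_eqI)
  moreover have "(\<lambda>a. ?e P a + ?e Q a) = ?e (P + Q)" for P Q by auto
  then have "(\<lambda>a. ?e P a + ?e Q a) \<in> range ?e" for P Q by (rule range_eqI)
  moreover have "(\<lambda>a. ?e P a * ?e Q a) = ?e (P * Q)" for P Q by auto
  then have "(\<lambda>a. ?e P a * ?e Q a) \<in> range ?e" for P Q by (rule range_eqI)
  ultimately show ?thesis unfolding function_algebra_def by blast
qed

text \<open>If the zeros of \<open>F\<close> are zeros of a nonzero \<open>h\<close> that is constant in the direction \<open>v\<close>, then \<open>F\<close> is constant
in that direction too. Otherwise, seen as a polynomial in the parameter \<open>t\<close> of this direction, \<open>F\<close> has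
positive degree and a leading coefficient \<open>l \<noteq> 0\<close>; at a point where neither \<open>l\<close> nor \<open>h\<close> vanishes, \<open>F\<close>
has a root on the line in direction \<open>v\<close>, but \<open>h\<close> has none there. This takes the place of the argument
that a divisor of \<open>h\<close> contains only variables of \<open>h\<close>.\<close>

lemma invariant_along_direction:
  fixes F h :: "'k::{alg_closed_field, field_char_0} vec \<Rightarrow> 'k"
  assumes F: "regular_function m F" and h: "regular_function m h" and v: "v \<in> carrier_vec m"
    and h_inv: "\<And>y t. y \<in> carrier_vec m \<Longrightarrow> h (y + t \<cdot>\<^sub>v v) = h y"
    and y\<^sub>0: "y\<^sub>0 \<in> carrier_vec m" "h y\<^sub>0 \<noteq> 0"
    and zeros: "\<And>y. y \<in> carrier_vec m \<Longrightarrow> F y = 0 \<Longrightarrow> h y = 0"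
    and y: "y \<in> carrier_vec m"
  shows "F (y + t \<cdot>\<^sub>v v) = F y"
proof -
  define l where "l u = y + u \<cdot>\<^sub>v (y\<^sub>0 - y)" for u
  have l: "poly_curve m l" "l 0 = y" "l 1 = y\<^sub>0"
    unfolding l_def using y y\<^sub>0 by (auto intro: poly_curve_line)
  have car: "l u \<in> carrier_vec m" for u using l(1) unfolding poly_curve_def by simp
  define c where "c = (\<lambda>(u, t). l u + t \<cdot>\<^sub>v v)"
  have c_car: "c a \<in> carrier_vec m" for a unfolding c_def using car v by (cases a) simp
  obtain Q where Q: "Q \<in> poly_ring m" "\<And>x. x \<in> carrier_vec m \<Longrightarrow> F x = eval_poly Q x"
    using F unfolding regular_function_def by auto
  have "(\<lambda>a. eval_poly Q (c a)) \<in> range (\<lambda>P (u, t). poly (poly P [:t:]) u)"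
  proof (rule eval_poly_in_function_algebra[OF function_algebra_bivariate Q(1)])
    fix i assume "i < m"
    then have "(\<lambda>a. c a $ i) = (\<lambda>(u, t). poly (poly [:[:y $ i, y\<^sub>0 $ i - y $ i:], [:v $ i:]:] [:t:]) u)"
      using y y\<^sub>0 v unfolding c_def l_def by (auto simp: fun_eq_iff)
    then show "(\<lambda>a. c a $ i) \<in> range (\<lambda>P (u, t). poly (poly P [:t:]) u)" by blast
  qed
  then obtain P where "(\<lambda>a. eval_poly Q (c a)) = (\<lambda>(u, t). poly (poly P [:t:]) u)" by blast
  then have "eval_poly Q (c (u, t)) = poly (poly P [:t:]) u" for u t by (metis case_prod_conv)
  then have P: "F (l u + t \<cdot>\<^sub>v v) = poly (map_poly (\<lambda>c. poly c u) P) t" for u t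
    using Q(2)[OF c_car, of "(u, t)"] by (simp add: poly_poly_slice c_def)
  obtain H where H: "\<And>u. h (l u) = poly H u" using regular_function_curve[OF h l(1)] by metis
  have "H \<noteq> 0" using H[of 1] l(3) y\<^sub>0(2) by auto
  have "Polynomial.degree P = 0"
  proof (rule ccontr)
    assume deg: "Polynomial.degree P \<noteq> 0"
    then have "lead_coeff P * H \<noteq> 0" using \<open>H \<noteq> 0\<close> by auto
    then obtain u where u: "poly (lead_coeff P) u \<noteq> 0" "poly H u \<noteq> 0"
      using poly_all_0_iff_0[of "lead_coeff P * H"] by auto
    let ?p = "map_poly (\<lambda>c. poly c u) P"
    have "coeff ?p (Polynomial.degree P) \<noteq> 0" using u(1) by (simp add: coeff_map_poly)
    then have "Polynomial.degree ?p > 0" using deg le_degree by fastforce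
    then obtain s where "poly ?p s = 0" using alg_closed_imp_poly_has_root by blast
    then have "h (l u + s \<cdot>\<^sub>v v) = 0" using P car v by (intro zeros) auto
    then show False using h_inv[OF car] H u(2) by simp
  qed
  then obtain a where "P = [:a:]" by (metis degree_0_id)
  then have "F (l 0 + t \<cdot>\<^sub>v v) = F (l 0 + 0 \<cdot>\<^sub>v v)" unfolding P by (simp add: map_poly_pCons)
  moreover have "y + 0 \<cdot>\<^sub>v v = y" using y v by (intro eq_vecI) auto
  ultimately show ?thesis using l(2) by simp
qed

section \<open>Singular points\<close>

lemma coeff_1_linear_power: "coeff ([:a, 1:] ^ e) 1 = of_nat e * (a :: 'k::field_char_0) ^ (e - 1)"
proof -
  have "coeff ([:a, 1:] ^ e) 1 = poly (pderiv ([:a, 1:] ^ e)) 0"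
    by (simp add: poly_0_coeff_0 coeff_pderiv)
  then show ?thesis by (simp add: pderiv_power pderiv_pCons)
qed

text \<open>The formal partial derivative is the derivative along a coordinate line, that is, the linear
coefficient of the restriction to this line.\<close>

lemma eval_partial_deriv:
  fixes P :: "'k::field_char_0 mvpoly"
  assumes P: "P \<in> poly_ring n" and i: "i < n" and q: "q \<in> carrier_vec n"
    and r: "\<And>t. eval_poly P (q + t \<cdot>\<^sub>v unit_vec n i) = poly r t"
  shows "eval_poly (partial_deriv i P) q = coeff r 1"
proof -
  define K where "K m = (\<Prod>j\<in>Poly_Mapping.keys m - {i}. (q $ j) ^ Poly_Mapping.lookup m j)" for m
  define a where "a m = Poly_Mapping.lookup m i" for m :: "nat \<Rightarrow>\<^sub>0 nat"
  have split: "(\<Prod>j\<in>insert i (Poly_Mapping.keys m). f j) =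
      (\<Prod>j\<in>Poly_Mapping.keys m - {i}. f j) * f i" for m :: "nat \<Rightarrow>\<^sub>0 nat" and f :: "nat \<Rightarrow> 'k"
    by (simp add: prod.insert_remove mult.commute)
  have value_on_line: "monom_value m (q + t \<cdot>\<^sub>v unit_vec n i) = poly (Polynomial.smult (K m) ([:q $ i, 1:] ^ a m)) t"
    if "m \<in> Poly_Mapping.keys P" for m t
  proof -
    have keys: "Poly_Mapping.keys m \<subseteq> {..<n}" using P that unfolding poly_ring_def by blast
    have "monom_value m (q + t \<cdot>\<^sub>v unit_vec n i) =
        (\<Prod>j\<in>Poly_Mapping.keys m - {i}. ((q + t \<cdot>\<^sub>v unit_vec n i) $ j) ^ Poly_Mapping.lookup m j) *
        ((q + t \<cdot>\<^sub>v unit_vec n i) $ i) ^ a m"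
      unfolding a_def by (subst monom_value_superset[of "insert i (Poly_Mapping.keys m)"]) (auto simp: split)
    also have "(\<Prod>j\<in>Poly_Mapping.keys m - {i}. ((q + t \<cdot>\<^sub>v unit_vec n i) $ j) ^ Poly_Mapping.lookup m j) = K m"
      unfolding K_def
    proof (intro prod.cong refl arg_cong2[where f="(^)"])
      fix j assume "j \<in> Poly_Mapping.keys m - {i}"
      then have "j < n" "j \<noteq> i" using keys by auto
      then show "(q + t \<cdot>\<^sub>v unit_vec n i) $ j = q $ j" using q i by simp
    qed
    finally show ?thesis using q i by (simp add: algebra_simps)
  qed
  have shifted: "of_nat (a m) * monom_value (m - Poly_Mapping.single i 1) q =
      coeff (Polynomial.smult (K m) ([:q $ i, 1:] ^ a m)) 1" for m
  proof -
    have "monom_value (m - Poly_Mapping.single i 1) q =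
        (\<Prod>j\<in>insert i (Poly_Mapping.keys m). (q $ j) ^ Poly_Mapping.lookup (m - Poly_Mapping.single i 1) j)"
      by (rule monom_value_superset) (auto simp: in_keys_iff lookup_minus)
    also have "\<dots> = K m * (q $ i) ^ (a m - 1)"
      unfolding split K_def a_def
      by (intro arg_cong2[where f="(*)"] prod.cong) (auto simp: lookup_minus lookup_single when_def)
    finally show ?thesis by (simp add: coeff_1_linear_power[simplified])
  qed
  have "r = (\<Sum>m \<in> Poly_Mapping.keys P. Polynomial.smult (Poly_Mapping.lookup P m) (Polynomial.smult (K m) ([:q $ i, 1:] ^ a m)))"
    unfolding poly_eq_poly_eq_iff[symmetric]
  proof
    fix t
    show "poly r t = poly (\<Sum>m \<in> Poly_Mapping.keys P.
        Polynomial.smult (Poly_Mapping.lookup P m) (Polynomial.smult (K m) ([:q $ i, 1:] ^ a m))) t"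
      unfolding r[symmetric] eval_poly_monom_value poly_sum using value_on_line by (intro sum.cong) simp_all
  qed
  then have "coeff r 1 = (\<Sum>m \<in> Poly_Mapping.keys P.
      Poly_Mapping.lookup P m * coeff (Polynomial.smult (K m) ([:q $ i, 1:] ^ a m)) 1)"
    by (simp add: coeff_sum mult.assoc)
  also have "\<dots> = eval_poly (partial_deriv i P) q"
    unfolding partial_deriv_def eval_poly_sum eval_poly_single shifted[symmetric]
    unfolding a_def
    by (intro sum.cong) (simp_all add: algebra_simps)
  finally show ?thesis by simp
qed

text \<open>Coordinate-free form of the condition that the tangent space of \<open>X\<close> at \<open>q\<close> is the whole ambient space.\<close>

definition singular_at :: "nat \<Rightarrow> 'k::comm_ring_1 vec set \<Rightarrow> 'k vec \<Rightarrow> bool" where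
  "singular_at n X q \<longleftrightarrow>
     (\<forall>g. regular_function n g \<longrightarrow> (\<forall>x\<in>X. g x = 0) \<longrightarrow> critical n g q)"

lemma singular_at_partial_derivs:
  fixes X :: "'k::field_char_0 vec set"
  assumes X: "X \<subseteq> carrier_vec n" and q: "q \<in> carrier_vec n"
  shows "singular_at n X q \<longleftrightarrow>
    (\<forall>f \<in> vanishing_ideal n X. \<forall>i<n. eval_poly (partial_deriv i f) q = 0)"
proof (intro iffI ballI allI impI)
  fix f i assume sing: "singular_at n X q" and f: "f \<in> vanishing_ideal n X" and i: "i < n"
  have f': "f \<in> poly_ring n" and reg: "regular_function n (eval_poly f)"
    using f regular_function_eval_poly unfolding vanishing_ideal_def by auto
  have crit: "critical n (eval_poly f) q"
    using sing f reg unfolding singular_at_def vanishing_ideal_def by auto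
  have curve: "poly_curve n (\<lambda>t. q + t \<cdot>\<^sub>v unit_vec n i)" using q by (intro poly_curve_line) auto
  obtain r where r: "\<And>t. eval_poly f (q + t \<cdot>\<^sub>v unit_vec n i) = poly r t"
    using regular_function_curve[OF reg curve] by metis
  then have "coeff r 1 = 0"
    using crit curve q unfolding critical_def by (auto dest!: spec[of _ "\<lambda>t. q + t \<cdot>\<^sub>v unit_vec n i"])
  then show "eval_poly (partial_deriv i f) q = 0" using eval_partial_deriv[OF f' i q r] by simp
next
  assume partials: "\<forall>f \<in> vanishing_ideal n X. \<forall>i<n. eval_poly (partial_deriv i f) q = 0"
  show "singular_at n X q"
    unfolding singular_at_def
  proof (intro allI impI)
    fix g assume g: "regular_function n g" "\<forall>x\<in>X. g x = 0"
    then obtain f where f: "f \<in> poly_ring n" "\<And>x. x \<in> carrier_vec n \<Longrightarrow> g x = eval_poly f x"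
      unfolding regular_function_def by auto
    then have I: "f \<in> vanishing_ideal n X" using g(2) X unfolding vanishing_ideal_def by force
    show "critical n g q"
    proof (rule critical_axes[OF g(1) q])
      fix i assume i: "i < n"
      have curve: "poly_curve n (\<lambda>t. q + t \<cdot>\<^sub>v unit_vec n i)" using q by (intro poly_curve_line) auto
      obtain r where r: "\<And>t. g (q + t \<cdot>\<^sub>v unit_vec n i) = poly r t"
        using regular_function_curve[OF g(1) curve] by metis
      then have "eval_poly (partial_deriv i f) q = coeff r 1"
        using f(2) q by (intro eval_partial_deriv[OF f(1) i q]) simp
      then show "\<exists>r. (\<forall>t. g (q + t \<cdot>\<^sub>v unit_vec n i) = poly r t) \<and> coeff r 1 = 0"
        using partials I i r by auto
    qed
  qed
qed

text \<open>A maximal linearly independent subset of \<open>W\<close> is a basis of \<open>W\<close>, and one with \<open>n\<close> elements also spans the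
whole space. For \<open>n = 0\<close> the difference \<open>n - 1\<close> truncates to \<open>0\<close> and both sides fail.\<close>

lemma full_dimension_iff:
  fixes W :: "'k::field vec set"
  assumes W: "VectorSpace.subspace class_ring W (module_vec TYPE('k) n)"
  shows "n - 1 < vectorspace.dim class_ring (module_vec TYPE('k) n\<lparr>carrier := W\<rparr>) \<longleftrightarrow>
    0 < n \<and> W = carrier_vec n"
proof -
  interpret vec_space "TYPE('k)" n .
  interpret W: vectorspace class_ring "module_vec TYPE('k) n\<lparr>carrier := W\<rparr>"
    using subspace_is_vs[OF W] .
  have sub: "submodule class_ring W V" using W by (simp add: VectorSpace.subspace_def)
  then have WV: "W \<subseteq> carrier_vec n" using submodule.subset by fastforce
  have indep: "W.lin_dep S = lin_dep S" and spans: "W.span S = span S" if "S \<subseteq> W" for S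
    using span_li_not_depend[OF that sub] by auto
  obtain B where B: "finite B" "maximal B (\<lambda>S. S \<subseteq> W \<and> W.lin_indpt S)"
  proof -
    have "\<exists>A. finite A \<and> maximal A (\<lambda>S. S \<subseteq> W \<and> W.lin_indpt S)"
    proof (rule maximal_exists[where N=n and B="{}"])
      show "finite S \<and> card S \<le> n" if "S \<subseteq> W \<and> W.lin_indpt S" for S
        using that WV indep li_le_dim[of S] dim_is_n by auto
      show "{} \<subseteq> W \<and> W.lin_indpt {}" by (simp add: W.lin_dep_def)
    qed
    then show ?thesis using that by blast
  qed
  have basis: "W.basis B" using B(2) by (intro W.max_li_is_basis) simp
  have BW: "B \<subseteq> W" and li: "lin_indpt B" using B(2) indep unfolding maximal_def by auto
  have dim: "W.dim = card B" by (rule W.dim_basis[OF B(1) basis])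
  have le: "card B \<le> n" using li_le_dim(2)[OF fin_dim _ li] BW WV dim_is_n by auto
  have "W = carrier_vec n" if "card B = n"
  proof -
    have "local.basis B"
      using dim_li_is_basis[OF fin_dim B(1) _ li] BW WV that dim_is_n by auto
    then have "span B = carrier_vec n" unfolding basis_def by simp
    moreover have "W.span B = W" using basis unfolding W.basis_def by simp
    ultimately show ?thesis using spans[OF BW] by simp
  qed
  moreover have "card B = n" if "W = carrier_vec n"
    using dim that dim_is_n by (simp add: module_vec_def)
  ultimately show ?thesis using dim le by auto
qed

lemma tangent_space_subspace:
  "VectorSpace.subspace class_ring (tangent_space n X p) (module_vec TYPE('k::field) n)"
proof -
  interpret vec_space "TYPE('k)" n .
  show ?thesis
    unfolding VectorSpace.subspace_def
  proof (intro conjI submodule.intro)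
    show "vectorspace class_ring V" "module class_ring V" by unfold_locales
  next
    fix v w assume "v \<in> tangent_space n X p" "w \<in> tangent_space n X p"
    then show "v \<oplus>\<^bsub>V\<^esub> w \<in> tangent_space n X p"
      unfolding tangent_space_def by (auto simp: module_vec_simps distrib_left sum.distrib)
  next
    fix c v assume c: "v \<in> tangent_space n X p"
    have "(\<Sum>i<n. eval_poly (partial_deriv i f) p * (c \<cdot>\<^sub>v v) $ i) =
        c * (\<Sum>i<n. eval_poly (partial_deriv i f) p * v $ i)" for f
      using c unfolding sum_distrib_left tangent_space_def by (intro sum.cong) (auto simp: algebra_simps)
    then show "c \<odot>\<^bsub>V\<^esub> v \<in> tangent_space n X p"
      using c unfolding tangent_space_def by (auto simp: module_vec_simps)
  qed (auto simp: tangent_space_def module_vec_simps)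
qed

lemma hypersurface_singular_locus_iff:
  fixes X :: "'k::field_char_0 vec set"
  assumes X: "X \<subseteq> carrier_vec n"
  shows "q \<in> hypersurface_singular_locus n X \<longleftrightarrow> 0 < n \<and> q \<in> X \<and> singular_at n X q"
proof -
  have "tangent_space n X q = carrier_vec n \<longleftrightarrow>
    (\<forall>f \<in> vanishing_ideal n X. \<forall>i<n. eval_poly (partial_deriv i f) q = 0)" (is "?l \<longleftrightarrow> ?r")
  proof
    assume ?l
    show ?r
    proof (intro ballI allI impI)
      fix f i assume f: "f \<in> vanishing_ideal n X" and i: "i < n"
      have "unit_vec n i \<in> tangent_space n X q" using \<open>?l\<close> by simp
      then have "(\<Sum>j<n. eval_poly (partial_deriv j f) q * unit_vec n i $ j) = 0"
        using f unfolding tangent_space_def by blast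
      also have "(\<Sum>j<n. eval_poly (partial_deriv j f) q * unit_vec n i $ j) =
          (\<Sum>j<n. if j = i then eval_poly (partial_deriv j f) q else 0)"
        using i by (intro sum.cong) auto
      finally show "eval_poly (partial_deriv i f) q = 0" using i by simp
    qed
  qed (auto simp: tangent_space_def)
  then show ?thesis
    using X full_dimension_iff[OF tangent_space_subspace] singular_at_partial_derivs[OF X]
    unfolding hypersurface_singular_locus_def by blast
qed

text \<open>Some equation \<open>f\<close> does not vanish at \<open>p\<close>, hence along the curve it vanishes for only finitely many
parameters. At all other parameters the curve is at \<open>p\<close>, and a polynomial with so many roots is zero.\<close>

lemma curve_through_isolated_point:
  fixes c :: "'k::field_char_0 \<Rightarrow> 'k vec"
  assumes iso: "zariski_isolated n S p" and c: "poly_curve n c" "c 0 = p" "\<And>t. c t \<in> S"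
  shows "c t = p"
proof -
  obtain E where E: "E \<subseteq> poly_ring n" and S: "S - zero_locus n E = {p}"
    using iso unfolding zariski_isolated_def zariski_closed_def by blast
  have car: "c t \<in> carrier_vec n" for t using c(1) unfolding poly_curve_def by simp
  have "p \<notin> zero_locus n E" using S by blast
  then obtain f where f: "f \<in> E" "eval_poly f p \<noteq> 0"
    using car[of 0] c(2) unfolding zero_locus_def by auto
  have "f \<in> poly_ring n" using E f(1) by blast
  then obtain r where r: "\<And>t. eval_poly f (c t) = poly r t"
    using regular_function_curve[OF regular_function_eval_poly c(1)] by metis
  have "r \<noteq> 0" using r[of 0] c(2) f(2) by auto
  obtain C where C: "\<And>i t. i < n \<Longrightarrow> c t $ i = poly (C i) t" using poly_curve_coords[OF c(1)] by metis
  have "C i = [:p $ i:]" if i: "i < n" for i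
  proof -
    have "poly (r * (C i - [:p $ i:])) t = 0" for t
    proof (cases "poly r t = 0")
      case False
      then have "eval_poly f (c t) \<noteq> 0" by (simp add: r)
      then have "c t \<notin> zero_locus n E" using f(1) unfolding zero_locus_def by blast
      then have "c t = p" using S c(3) by blast
      then show ?thesis using C[OF i, of t] by simp
    qed simp
    then have "r * (C i - [:p $ i:]) = 0" using poly_all_0_iff_0 by blast
    then show ?thesis using \<open>r \<noteq> 0\<close> by simp
  qed
  then have "c t $ i = p $ i" if "i < n" for i using C[OF that, of t] that by simp
  then show ?thesis using car[of t] car[of 0] c(2) by (intro eq_vecI) auto
qed

section \<open>Products with affine space\<close>

lemma regular_map_vec_first: "regular_map (n + d) n (\<lambda>w. vec_first w n)"
  unfolding regular_map_def by (auto simp: vec_first_def intro!: regular_function_coordinate)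

lemma regular_map_append:
  assumes z: "z \<in> carrier_vec d"
  shows "regular_map n (n + d) (\<lambda>x. x @\<^sub>v z)"
  unfolding regular_map_def
proof (intro conjI allI impI)
  show "(\<lambda>x. x @\<^sub>v z) \<in> carrier_vec n \<rightarrow> carrier_vec (n + d)" using z by auto
  fix i assume i: "i < n + d"
  show "regular_function n (\<lambda>x. (x @\<^sub>v z) $ i)"
  proof (cases "i < n")
    case True
    then show ?thesis using z
      by (auto intro: regular_function_cong[OF regular_function_coordinate[OF True]])
  next
    case False
    have "regular_function n (\<lambda>_. z $ (i - n))" using function_algebraD(1)[OF function_algebra_regular] by blast
    then show ?thesis by (rule regular_function_cong) (use False i z in auto)
  qed
qed

lemma vec_first_append: "x \<in> carrier_vec n \<Longrightarrow> vec_first (x @\<^sub>v z) n = x"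
  by (auto simp: vec_first_def)

lemma vec_last_append: "z \<in> carrier_vec d \<Longrightarrow> vec_last (x @\<^sub>v z) d = z"
  by (auto simp: vec_last_def)

text \<open>The singular locus of \<open>X \<times> \<bbbA>\<^sup>d\<close> contains the product of the singular locus of \<open>X\<close> with \<open>\<bbbA>\<^sup>d\<close>: a function
vanishing on the product is critical along \<open>X\<close> by hypothesis and constant along \<open>\<bbbA>\<^sup>d\<close>.\<close>

lemma critical_product:
  fixes G :: "'k::field_char_0 vec \<Rightarrow> 'k"
  assumes G: "regular_function (n + d) G" and X: "X \<subseteq> carrier_vec n"
    and zero: "\<And>x z. x \<in> X \<Longrightarrow> z \<in> carrier_vec d \<Longrightarrow> G (x @\<^sub>v z) = 0"
    and p: "p \<in> X" "singular_at n X p" and z: "z \<in> carrier_vec d"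
  shows "critical (n + d) G (p @\<^sub>v z)"
proof (rule critical_axes[OF G])
  have p': "p \<in> carrier_vec n" using X p(1) by blast
  then show "p @\<^sub>v z \<in> carrier_vec (n + d)" using z by simp
  fix i assume i: "i < n + d"
  show "\<exists>r. (\<forall>t. G ((p @\<^sub>v z) + t \<cdot>\<^sub>v unit_vec (n + d) i) = poly r t) \<and> coeff r 1 = 0"
  proof (cases "i < n")
    case True
    have reg: "regular_function n (\<lambda>x. G (x @\<^sub>v z))"
      by (rule regular_function_compose[OF G regular_map_append[OF z]])
    let ?c = "\<lambda>t. p + t \<cdot>\<^sub>v unit_vec n i"
    have curve: "poly_curve n ?c" "?c 0 = p" using p' by (auto intro: poly_curve_line)
    obtain r where r: "\<And>t. G (?c t @\<^sub>v z) = poly r t" using regular_function_curve[OF reg curve(1)] by metis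
    have "critical n (\<lambda>x. G (x @\<^sub>v z)) p" using p(2) reg zero z unfolding singular_at_def by blast
    then have "coeff r 1 = 0" using curve r unfolding critical_def by blast
    moreover have "(p @\<^sub>v z) + t \<cdot>\<^sub>v unit_vec (n + d) i = ?c t @\<^sub>v z" for t
      using p' z True by (intro eq_vecI) auto
    ultimately show ?thesis using r by auto
  next
    case False
    have "(p @\<^sub>v z) + t \<cdot>\<^sub>v unit_vec (n + d) i = p @\<^sub>v (z + t \<cdot>\<^sub>v unit_vec d (i - n))" for t
      using p' z False i by (intro eq_vecI) auto
    then have "G ((p @\<^sub>v z) + t \<cdot>\<^sub>v unit_vec (n + d) i) = 0" for t
      using zero[OF p(1)] z by simp
    then show ?thesis by (intro exI[of _ 0]) simp
  qed
qed

text \<open>Automorphisms of the ambient space that preserve \<open>X \<times> \<bbbA>\<^sup>d\<close> preserve its singular locus.\<close>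

lemma singular_at_transport:
  fixes X :: "'k::field_char_0 vec set"
  assumes X: "X \<subseteq> carrier_vec n" and p: "p \<in> X" "singular_at n X p" and z: "z \<in> carrier_vec d"
    and T: "regular_map (n + d) (n + d) T" and T': "regular_map (n + d) (n + d) T'"
    and TT': "\<And>w. w \<in> carrier_vec (n + d) \<Longrightarrow> T (T' w) = w"
    and T'T: "\<And>w. w \<in> carrier_vec (n + d) \<Longrightarrow> T' (T w) = w"
    and pres: "\<And>w. w \<in> carrier_vec (n + d) \<Longrightarrow> vec_first w n \<in> X \<Longrightarrow> vec_first (T w) n \<in> X"
  shows "singular_at n X (vec_first (T (p @\<^sub>v z)) n)"
  unfolding singular_at_def
proof (intro allI impI)
  fix f assume f: "regular_function n f" "\<forall>x\<in>X. f x = 0"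
  let ?w = "T (p @\<^sub>v z)" and ?u = "vec_last (T (p @\<^sub>v z)) d"
  have pz: "p @\<^sub>v z \<in> carrier_vec (n + d)" using X p z by auto
  have w: "?w \<in> carrier_vec (n + d)" using pz T unfolding regular_map_def by blast
  have "critical (n + d) (\<lambda>w. f (vec_first (T w) n)) (p @\<^sub>v z)"
  proof (rule critical_product[OF _ X _ p z])
    show "regular_function (n + d) (\<lambda>w. f (vec_first (T w) n))"
      by (rule regular_function_compose[OF f(1) regular_map_compose[OF regular_map_vec_first T]])
    show "f (vec_first (T (x @\<^sub>v z)) n) = 0" if "x \<in> X" "z \<in> carrier_vec d" for x z
      using f(2) pres[of "x @\<^sub>v z"] that X vec_first_append[of x n z] by auto
  qed
  then have "critical (n + d) (\<lambda>w. f (vec_first (T w) n)) (T' ?w)" using T'T[OF pz] by simp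
  then have "critical (n + d) (\<lambda>w. f (vec_first (T (T' w)) n)) ?w" by (rule critical_pullback[OF _ T'])
  then have "critical (n + d) (\<lambda>w. f (vec_first w n)) ?w"
    by (rule critical_cong) (use TT' in simp)
  then have "critical (n + d) (\<lambda>w. f (vec_first w n)) (vec_first ?w n @\<^sub>v ?u)" using w by simp
  then have "critical n (\<lambda>x. f (vec_first (x @\<^sub>v ?u) n)) (vec_first ?w n)"
    by (rule critical_pullback[where T="\<lambda>x. x @\<^sub>v ?u"]) (rule regular_map_append, simp)
  then show "critical n f (vec_first ?w n)"
    by (rule critical_cong) (simp add: vec_first_append)
qed

section \<open>Triangular actions\<close>

text \<open>The first coordinate \<open>k\<close> that the action moves is changed by \<open>y\<^sub>k \<mapsto> a(t) y\<^sub>k + f\<^sub>t(y\<^sub>0, \<dots>, y\<^sub>k\<^sub>-\<^sub>1)\<close>. As the earlier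
coordinates are invariant, \<open>a\<close> is multiplicative in \<open>t\<close>; being polynomial with polynomial inverse
\<open>a(- t)\<close>, it is constant \<open>1\<close>. Fixed points are therefore zeros of some \<open>f\<^sub>t \<noteq> 0\<close>, a function of the first
\<open>k\<close> coordinates only.\<close>

lemma triangular_action_first_moved_coordinate:
  fixes \<Theta> :: "'k::field_char_0 \<Rightarrow> 'k vec \<Rightarrow> 'k vec"
  assumes car: "\<And>t y. y \<in> carrier_vec m \<Longrightarrow> \<Theta> t y \<in> carrier_vec m"
    and add: "\<And>s t y. y \<in> carrier_vec m \<Longrightarrow> \<Theta> (s + t) y = \<Theta> s (\<Theta> t y)"
    and zero: "\<And>y. y \<in> carrier_vec m \<Longrightarrow> \<Theta> 0 y = y"
    and curve: "\<And>y. y \<in> carrier_vec m \<Longrightarrow> poly_curve m (\<lambda>t. \<Theta> t y)"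
    and triangular: "\<And>t. \<exists>a f. \<forall>i<m. f i \<in> poly_ring i \<and>
      (\<forall>y\<in>carrier_vec m. \<Theta> t y $ i = a i * y $ i + eval_poly (f i) y)"
    and nontrivial: "y\<^sub>0 \<in> carrier_vec m" "\<Theta> t\<^sub>0 y\<^sub>0 \<noteq> y\<^sub>0"
  obtains k h y\<^sub>1 where "k < m" "h \<in> poly_ring k"
    and "\<And>t y i. y \<in> carrier_vec m \<Longrightarrow> i < k \<Longrightarrow> \<Theta> t y $ i = y $ i"
    and "y\<^sub>1 \<in> carrier_vec m" "eval_poly h y\<^sub>1 \<noteq> 0"
    and "\<forall>y\<in>carrier_vec m. (\<forall>t. \<Theta> t y = y) \<longrightarrow> eval_poly h y = 0"
proof -
  define moved where "moved k \<longleftrightarrow> k < m \<and> (\<exists>t. \<exists>y\<in>carrier_vec m. \<Theta> t y $ k \<noteq> y $ k)" for k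
  define k where "k = (LEAST k. moved k)"
  have "\<exists>i<m. \<Theta> t\<^sub>0 y\<^sub>0 $ i \<noteq> y\<^sub>0 $ i"
    using nontrivial car[OF nontrivial(1), of t\<^sub>0] by (metis carrier_vecD eq_vecI)
  then have "moved k" unfolding k_def using nontrivial(1) moved_def by (metis LeastI)
  then have k: "k < m" unfolding moved_def by blast
  have fixed: "\<Theta> t y $ i = y $ i" if "y \<in> carrier_vec m" "i < k" for t y i
    using not_less_Least[of i moved] that k unfolding k_def moved_def by fastforce
  have "\<forall>t. \<exists>a f. f \<in> poly_ring k \<and>
      (\<forall>y\<in>carrier_vec m. \<Theta> t y $ k = a * y $ k + eval_poly f y)"
    using triangular k by metis
  then obtain A f where f: "\<And>t. f t \<in> poly_ring k"
    and A: "\<And>t y. y \<in> carrier_vec m \<Longrightarrow> \<Theta> t y $ k = A t * y $ k + eval_poly (f t) y"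
    by metis
  define e where "e = (unit_vec m k :: 'k vec)"
  define z where "z = (0\<^sub>v m :: 'k vec)"
  have ez: "e \<in> carrier_vec m" "z \<in> carrier_vec m" "e $ k = 1" "z $ k = 0"
    and ez_below: "\<And>i. i < k \<Longrightarrow> e $ i = z $ i"
    using k unfolding e_def z_def by auto
  have A_diff: "A t = \<Theta> t e $ k - \<Theta> t z $ k" for t
    using A[OF ez(1), of t] A[OF ez(2), of t] eval_poly_cong[OF f ez_below, of t] ez by simp
  have A_add: "A (s + t) = A s * A t" for s t
  proof -
    have "eval_poly (f s) (\<Theta> t e) = eval_poly (f s) (\<Theta> t z)"
      by (rule eval_poly_cong[OF f]) (simp add: fixed ez ez_below)
    then have "A (s + t) = A s * (\<Theta> t e $ k - \<Theta> t z $ k)"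
      unfolding A_diff[of "s + t"] by (simp add: add ez A[OF car] algebra_simps)
    then show ?thesis by (simp add: A_diff)
  qed
  have A_0: "A 0 = 1" unfolding A_diff by (simp add: zero ez)
  obtain p q where p: "\<And>t. \<Theta> t e $ k = poly p t" and q: "\<And>t. \<Theta> t z $ k = poly q t"
    using curve[OF ez(1)] curve[OF ez(2)] k by (metis poly_curve_coords)
  \<comment> \<open>The identity \<open>a(t) a(- t) = 1\<close> between polynomials.\<close>
  have "poly ((p - q) * pcompose (p - q) [:0, -1:]) t = poly 1 t" for t
    using A_add[of t "- t"] by (simp add: poly_pcompose A_diff[symmetric] p[symmetric] q[symmetric] A_0)
  then have "(p - q) * pcompose (p - q) [:0, -1:] = 1" by (intro poly_ext) 
  then have "is_unit (p - q)" by (metis dvd_triv_left)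
  then have "Polynomial.degree (p - q) = 0" by (metis is_unit_iff_degree not_is_unit_0)
  then obtain a where "p - q = [:a:]" by (metis degree_0_id)
  then have "A t = a" for t by (simp add: A_diff p q flip: poly_diff)
  then have A_1: "A t = 1" for t using A_0 by simp
  obtain t\<^sub>1 y\<^sub>1 where y\<^sub>1: "y\<^sub>1 \<in> carrier_vec m" "\<Theta> t\<^sub>1 y\<^sub>1 $ k \<noteq> y\<^sub>1 $ k"
    using \<open>moved k\<close> unfolding moved_def by blast
  show ?thesis
  proof (rule that[OF k f fixed y\<^sub>1(1)])
    show "eval_poly (f t\<^sub>1) y\<^sub>1 \<noteq> 0" using y\<^sub>1 A[OF y\<^sub>1(1), of t\<^sub>1] A_1 by simp
    show "\<forall>y\<in>carrier_vec m. (\<forall>t. \<Theta> t y = y) \<longrightarrow> eval_poly (f t\<^sub>1) y = 0"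
    proof (intro ballI impI)
      fix y assume y: "y \<in> carrier_vec m" "\<forall>t. \<Theta> t y = y"
      then have "\<Theta> t\<^sub>1 y $ k = y $ k" by simp
      then show "eval_poly (f t\<^sub>1) y = 0" using A[OF y(1), of t\<^sub>1] A_1 by simp
    qed
  qed
qed

section \<open>Conjugation to triangular form\<close>

lemma aut_group_mult:
  "f \<in> Bij (carrier_vec m) \<Longrightarrow> g \<in> Bij (carrier_vec m) \<Longrightarrow>
    f \<otimes>\<^bsub>aut_group m\<^esub> g = compose (carrier_vec m) f g"
  by (simp add: aut_group_def BijGroup_def)

lemma aut_group_inv:
  fixes \<psi> :: "'k::comm_ring_1 vec \<Rightarrow> 'k vec"
  assumes \<psi>: "\<psi> \<in> carrier (aut_group m)"
  shows "inv\<^bsub>aut_group m\<^esub> \<psi> = (\<lambda>x \<in> carrier_vec m. inv_into (carrier_vec m) \<psi> x)"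
proof -
  let ?C = "carrier_vec m :: 'k vec set" and ?\<alpha> = "\<lambda>x \<in> carrier_vec m. inv_into (carrier_vec m) \<psi> x"
  have \<psi>': "\<psi> \<in> Bij ?C" "regular_map m m \<psi>" "regular_map m m (inv_into ?C \<psi>)"
    using \<psi> by (auto simp: aut_group_def)
  have bij: "bij_betw \<psi> ?C ?C" using \<psi>'(1) by (simp add: Bij_def)
  have \<alpha>: "?\<alpha> \<in> Bij ?C" by (rule restrict_inv_into_Bij[OF \<psi>'(1)])
  have "inv_into ?C ?\<alpha> x = \<psi> x" if x: "x \<in> ?C" for x
  proof (rule inv_into_f_eq)
    show "inj_on ?\<alpha> ?C" using \<alpha> by (simp add: Bij_def bij_betw_def)
    show "\<psi> x \<in> ?C" using bij x by (auto simp: bij_betw_def)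
    then show "?\<alpha> (\<psi> x) = x" using bij x by (simp add: bij_betw_inv_into_left)
  qed
  then have "regular_map m m (inv_into ?C ?\<alpha>)" by (intro regular_map_cong[OF \<psi>'(2)]) simp
  moreover have "regular_map m m ?\<alpha>" by (rule regular_map_cong[OF \<psi>'(3)]) simp
  ultimately have \<alpha>_aut: "?\<alpha> \<in> carrier (aut_group m)" using \<alpha> by (simp add: aut_group_def)
  have one: "\<one>\<^bsub>aut_group m\<^esub> = (\<lambda>x \<in> ?C. x)" by (simp add: aut_group_def BijGroup_def)
  show ?thesis
    unfolding m_inv_def
  proof (rule the_equality)
    have "compose ?C \<psi> ?\<alpha> = (\<lambda>x \<in> ?C. x)"
      using bij by (auto simp: compose_def restrict_def fun_eq_iff bij_betw_inv_into_right)
    then show "?\<alpha> \<in> carrier (aut_group m) \<and> \<psi> \<otimes>\<^bsub>aut_group m\<^esub> ?\<alpha> = \<one>\<^bsub>aut_group m\<^esub> \<and>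
        ?\<alpha> \<otimes>\<^bsub>aut_group m\<^esub> \<psi> = \<one>\<^bsub>aut_group m\<^esub>"
      using \<alpha>_aut \<psi>'(1) \<alpha> by (simp add: aut_group_mult one Bij_compose_restrict_eq)
  next
    fix \<beta> :: "'k vec \<Rightarrow> 'k vec"
    assume \<beta>: "\<beta> \<in> carrier (aut_group m) \<and> \<psi> \<otimes>\<^bsub>aut_group m\<^esub> \<beta> = \<one>\<^bsub>aut_group m\<^esub> \<and>
        \<beta> \<otimes>\<^bsub>aut_group m\<^esub> \<psi> = \<one>\<^bsub>aut_group m\<^esub>"
    then have \<beta>': "\<beta> \<in> Bij ?C" by (simp add: aut_group_def)
    then have "compose ?C \<psi> \<beta> = (\<lambda>x \<in> ?C. x)" using \<beta> \<psi>'(1) by (simp add: aut_group_mult one)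
    then have right: "\<psi> (\<beta> x) = x" if "x \<in> ?C" for x
      using that by (metis compose_eq restrict_apply')
    show "\<beta> = ?\<alpha>"
    proof (rule extensionalityI[of _ ?C])
      show "\<beta> \<in> extensional ?C" using \<beta>' by (rule Bij_imp_extensional)
      fix x assume x: "x \<in> ?C"
      then have "\<beta> x \<in> ?C" using Bij_imp_funcset[OF \<beta>'] by blast
      then show "\<beta> x = ?\<alpha> x" using right[OF x] bij x by (simp add: bij_betw_def inv_into_f_eq)
    qed simp
  qed
qed

lemma Ga_actionD:
  assumes "group_action additive_group C \<phi>"
  shows "\<phi> t \<in> Bij C" "x \<in> C \<Longrightarrow> \<phi> (s + t) x = \<phi> s (\<phi> t x)" "x \<in> C \<Longrightarrow> \<phi> 0 x = x"
    "x \<in> C \<Longrightarrow> \<phi> t x \<in> C"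
proof -
  interpret group_hom additive_group "BijGroup C" \<phi> using assms by (simp add: group_action_def)
  show bij: "\<phi> t \<in> Bij C" for t
    using hom_closed[of t] by (simp add: additive_group_def BijGroup_def)
  show "\<phi> (s + t) x = \<phi> s (\<phi> t x)" if "x \<in> C"
    using hom_mult[of s t] that bij by (simp add: additive_group_def BijGroup_def compose_eq)
  show "\<phi> 0 x = x" if "x \<in> C"
    using hom_one that by (simp add: additive_group_def BijGroup_def)
  show "\<phi> t x \<in> C" if "x \<in> C" using Bij_imp_funcset[OF bij] that by blast
qed

lemma trivial_extension_eq:
  "w \<in> carrier_vec (n + d) \<Longrightarrow> trivial_extension n d \<phi> t w = \<phi> t (vec_first w n) @\<^sub>v vec_last w d"
  by (simp add: trivial_extension_def)

lemma trivial_extension_add: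
  assumes act: "group_action additive_group (carrier_vec n) \<phi>" and w: "w \<in> carrier_vec (n + d)"
  shows "trivial_extension n d \<phi> t w \<in> carrier_vec (n + d)"
    "trivial_extension n d \<phi> (s + t) w = trivial_extension n d \<phi> s (trivial_extension n d \<phi> t w)"
    "trivial_extension n d \<phi> 0 w = w"
proof -
  note phi = Ga_actionD[OF act]
  show car: "trivial_extension n d \<phi> t w \<in> carrier_vec (n + d)"
    using w by (simp add: trivial_extension_eq phi(4))
  show "trivial_extension n d \<phi> (s + t) w = trivial_extension n d \<phi> s (trivial_extension n d \<phi> t w)"
    unfolding trivial_extension_eq[OF car] unfolding trivial_extension_eq[OF w]
    by (simp add: vec_first_append vec_last_append phi(2,4))
  show "trivial_extension n d \<phi> 0 w = w" using w by (simp add: trivial_extension_eq phi(3))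
qed

lemma trivial_extension_Bij:
  assumes act: "group_action additive_group (carrier_vec n) \<phi>"
  shows "trivial_extension n d \<phi> t \<in> Bij (carrier_vec (n + d))"
proof -
  have "bij_betw (trivial_extension n d \<phi> t) (carrier_vec (n + d)) (carrier_vec (n + d))"
    using trivial_extension_add[OF act, where d=d]
    by (intro bij_betw_byWitness[where f'="trivial_extension n d \<phi> (- t)"])
      (auto simp flip: trivial_extension_add(2)[OF act])
  then show ?thesis by (simp add: Bij_def trivial_extension_def)
qed

text \<open>Membership in the de Jonquieres group unfolded to points: after the coordinate change \<open>\<psi>\<close>, each
element of the group acts by a triangular map.\<close>

lemma triangulating_coordinates:
  assumes act: "group_action additive_group (carrier_vec n) \<phi>"
    and tri: "triangulable (n + d) (trivial_extension n d \<phi>)"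
  obtains \<psi> \<alpha> where "regular_map (n + d) (n + d) \<psi>" "regular_map (n + d) (n + d) \<alpha>"
    and "\<And>w. w \<in> carrier_vec (n + d) \<Longrightarrow> \<psi> (\<alpha> w) = w"
    and "\<And>w. w \<in> carrier_vec (n + d) \<Longrightarrow> \<alpha> (\<psi> w) = w"
    and "\<And>t. \<exists>a f. \<forall>i<n + d. f i \<in> poly_ring i \<and> (\<forall>y\<in>carrier_vec (n + d).
      \<psi> (trivial_extension n d \<phi> t (\<alpha> y)) $ i = a i * y $ i + eval_poly (f i) y)"
proof -
  let ?C = "carrier_vec (n + d)" and ?G = "aut_group (n + d)" and ?\<Phi> = "trivial_extension n d \<phi>"
  obtain \<psi> H where \<psi>: "\<psi> \<in> carrier ?G" and H: "H \<subseteq> jonq (n + d)"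
    "(\<lambda>g. \<psi> \<otimes>\<^bsub>?G\<^esub> g \<otimes>\<^bsub>?G\<^esub> inv\<^bsub>?G\<^esub> \<psi>) ` range ?\<Phi> = H"
    using tri unfolding triangulable_def by blast
  define \<alpha> where "\<alpha> = inv\<^bsub>?G\<^esub> \<psi>"
  have \<alpha>: "\<alpha> = (\<lambda>x \<in> ?C. inv_into ?C \<psi> x)" unfolding \<alpha>_def by (rule aut_group_inv[OF \<psi>])
  have \<psi>': "\<psi> \<in> Bij ?C" "regular_map (n + d) (n + d) \<psi>" "regular_map (n + d) (n + d) (inv_into ?C \<psi>)"
    using \<psi> by (auto simp: aut_group_def)
  have bij: "bij_betw \<psi> ?C ?C" using \<psi>'(1) by (simp add: Bij_def)
  have \<alpha>_bij: "\<alpha> \<in> Bij ?C" unfolding \<alpha> by (rule restrict_inv_into_Bij[OF \<psi>'(1)])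
  show ?thesis
  proof (rule that[OF \<psi>'(2)])
    show "regular_map (n + d) (n + d) \<alpha>" by (rule regular_map_cong[OF \<psi>'(3)]) (simp add: \<alpha>)
    show "\<psi> (\<alpha> w) = w" if "w \<in> ?C" for w using that bij by (simp add: \<alpha> bij_betw_inv_into_right)
    show "\<alpha> (\<psi> w) = w" if "w \<in> ?C" for w
      using that bij Bij_imp_funcset[OF \<psi>'(1)] by (auto simp: \<alpha> bij_betw_inv_into_left)
    fix t
    have "\<psi> \<otimes>\<^bsub>?G\<^esub> ?\<Phi> t \<otimes>\<^bsub>?G\<^esub> \<alpha> \<in> jonq (n + d)" using H unfolding \<alpha>_def by blast
    also have "\<psi> \<otimes>\<^bsub>?G\<^esub> ?\<Phi> t \<otimes>\<^bsub>?G\<^esub> \<alpha> = compose ?C (compose ?C \<psi> (?\<Phi> t)) \<alpha>"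
      using \<psi>'(1) \<alpha>_bij trivial_extension_Bij[OF act]
      by (simp add: aut_group_mult compose_Bij)
    finally obtain a f where "\<forall>i<n + d. a i \<noteq> 0 \<and> f i \<in> poly_ring i \<and> (\<forall>y\<in>?C.
        compose ?C (compose ?C \<psi> (?\<Phi> t)) \<alpha> y $ i = a i * y $ i + eval_poly (f i) y)"
      unfolding jonq_def by blast
    moreover have "compose ?C (compose ?C \<psi> (?\<Phi> t)) \<alpha> y = \<psi> (?\<Phi> t (\<alpha> y))" if "y \<in> ?C" for y
      using that Bij_imp_funcset[OF \<alpha>_bij] by (auto simp: compose_def)
    ultimately show "\<exists>a f. \<forall>i<n + d. f i \<in> poly_ring i \<and> (\<forall>y\<in>?C.
        \<psi> (?\<Phi> t (\<alpha> y)) $ i = a i * y $ i + eval_poly (f i) y)"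
      by (intro exI[of _ a] exI[of _ f]) simp
  qed
qed

lemma regular_Ga_action_curve:
  assumes "regular_Ga_action n \<phi>" "x \<in> carrier_vec n"
  shows "poly_curve n (\<lambda>t. \<phi> t x)"
proof -
  let ?c = "\<lambda>t. x @\<^sub>v vec 1 (\<lambda>_. t)"
  have "poly_curve (n + 1) ?c"
    unfolding poly_curve_def
  proof (intro conjI allI impI)
    fix i assume "i < n + 1"
    then have "(\<lambda>t. ?c t $ i) = poly (if i < n then [:x $ i:] else [:0, 1:])"
      using assms(2) by (auto simp: fun_eq_iff)
    then show "(\<lambda>t. ?c t $ i) \<in> range poly" by (rule range_eqI)
  next
    show "?c t \<in> carrier_vec (n + 1)" for t using assms(2) by (intro append_carrier_vec) auto
  qed
  from regular_map_curve[OF _ this] assms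
  have "poly_curve n (\<lambda>t. \<phi> (?c t $ n) (vec_first (?c t) n))" unfolding regular_Ga_action_def by blast
  then show ?thesis using assms(2) by (simp add: vec_first_append)
qed

lemma regular_Ga_action_regular_map:
  assumes "regular_Ga_action n \<phi>"
  shows "regular_map n n (\<phi> t)"
proof -
  have "regular_map n n (\<lambda>x. \<phi> ((x @\<^sub>v vec 1 (\<lambda>_. t)) $ n) (vec_first (x @\<^sub>v vec 1 (\<lambda>_. t)) n))"
    using assms unfolding regular_Ga_action_def
    by (intro regular_map_compose[OF _ regular_map_append]) auto
  then show ?thesis by (rule regular_map_cong) (simp add: vec_first_append)
qed

text \<open>Every point of the whole space counts as singular in the sense of a tangent space larger than a
hyperplane, and no point of a line is isolated.\<close>

lemma isolated_singularity_not_whole_space: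
  fixes X :: "'k::field_char_0 vec set"
  assumes "has_isolated_singularity n X"
  shows "X \<noteq> carrier_vec n"
proof
  assume X: "X = carrier_vec n"
  obtain p where p: "p \<in> hypersurface_singular_locus n X"
    and iso: "zariski_isolated n (hypersurface_singular_locus n X) p"
    using assms unfolding has_isolated_singularity_def by blast
  have n: "0 < n" and p': "p \<in> carrier_vec n" using p hypersurface_singular_locus_iff[of X n] X by auto
  have "singular_at n X q" for q :: "'k vec"
    unfolding singular_at_def X
  proof (intro allI impI)
    fix g :: "'k vec \<Rightarrow> 'k"
    assume g: "regular_function n g" "\<forall>x\<in>carrier_vec n. g x = 0"
    show "critical n g q"
      unfolding critical_def
    proof (intro allI impI)
      fix c r assume "poly_curve n c" "\<forall>t. g (c t) = poly r t"
      then have "poly r t = 0" for t using g(2) unfolding poly_curve_def by metis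
      then have "r = 0" using poly_all_0_iff_0 by blast
      then show "coeff r 1 = 0" by simp
    qed
  qed
  then have sing: "q \<in> hypersurface_singular_locus n X" if "q \<in> carrier_vec n" for q
    using hypersurface_singular_locus_iff[of X n] X n that by blast
  let ?c = "\<lambda>t. p + t \<cdot>\<^sub>v unit_vec n 0"
  have "?c 1 = p"
  proof (rule curve_through_isolated_point[OF iso])
    show "poly_curve n ?c" "?c 0 = p" using p' by (auto intro: poly_curve_line)
    show "?c t \<in> hypersurface_singular_locus n X" for t using p' by (intro sing) auto
  qed
  then have "?c 1 $ 0 = p $ 0" by simp
  then show False using n p' by simp
qed

section \<open>Actions fixing a hypersurface with an isolated singularity\<close>

theorem proposition1p4p1:
  fixes n :: nat
    and \<phi> :: "'k::{alg_closed_field, field_char_0} \<Rightarrow> 'k vec \<Rightarrow> 'k vec"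
  assumes "regular_Ga_action n \<phi>"
    and "hypersurface n (fixed_points n \<phi>)"
    and "has_isolated_singularity n (fixed_points n \<phi>)"
  shows "\<not> stably_triangulable n \<phi>"
proof
  assume "stably_triangulable n \<phi>"
  then obtain d where tri: "triangulable (n + d) (trivial_extension n d \<phi>)"
    unfolding stably_triangulable_def by blast
  define X where "X = fixed_points n \<phi>"
  define m where "m = n + d"
  let ?C = "carrier_vec m :: 'k vec set" and ?\<Phi> = "trivial_extension n d \<phi>" and ?o = "0\<^sub>v d :: 'k vec"
  have act: "group_action additive_group (carrier_vec n) \<phi>"
    using assms(1) unfolding regular_Ga_action_def by blast
  have X: "X \<subseteq> carrier_vec n" unfolding X_def fixed_points_def by blast
  obtain f where f: "f \<in> poly_ring n" "X = zero_locus n {f}"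
    using assms(2) unfolding hypersurface_def X_def by blast
  have X_iff: "x \<in> X \<longleftrightarrow> eval_poly f x = 0" if "x \<in> carrier_vec n" for x
    using that f(2) unfolding zero_locus_def by simp
  obtain p where p: "p \<in> hypersurface_singular_locus n X"
    and iso: "zariski_isolated n (hypersurface_singular_locus n X) p"
    using assms(3) unfolding has_isolated_singularity_def X_def by blast
  have n: "0 < n" and pX: "p \<in> X" and p_sing: "singular_at n X p"
    using p hypersurface_singular_locus_iff[OF X] by auto
  have p_car: "p \<in> carrier_vec n" using X pX by blast
  have "X \<noteq> carrier_vec n"
    unfolding X_def by (rule isolated_singularity_not_whole_space[OF assms(3)])
  then obtain x\<^sub>0 t\<^sub>0 where x\<^sub>0: "x\<^sub>0 \<in> carrier_vec n" "\<phi> t\<^sub>0 x\<^sub>0 \<noteq> x\<^sub>0"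
    unfolding X_def fixed_points_def by blast
  obtain \<psi> \<alpha> where \<psi>: "regular_map m m \<psi>" and \<alpha>: "regular_map m m \<alpha>"
    and \<psi>\<alpha>: "\<And>w. w \<in> ?C \<Longrightarrow> \<psi> (\<alpha> w) = w" and \<alpha>\<psi>: "\<And>w. w \<in> ?C \<Longrightarrow> \<alpha> (\<psi> w) = w"
    and jonq: "\<And>t. \<exists>a f. \<forall>i<m. f i \<in> poly_ring i \<and>
      (\<forall>y\<in>?C. \<psi> (?\<Phi> t (\<alpha> y)) $ i = a i * y $ i + eval_poly (f i) y)"
    by (rule triangulating_coordinates[OF act tri, folded m_def]) (rule that)
  have \<psi>_car: "\<psi> w \<in> ?C" and \<alpha>_car: "\<alpha> w \<in> ?C" if "w \<in> ?C" for w
    using \<psi> \<alpha> that unfolding regular_map_def by auto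
  note \<Phi> = trivial_extension_add[OF act, where d=d, folded m_def]
  have \<Phi>_eq: "?\<Phi> t (x @\<^sub>v z) = \<phi> t x @\<^sub>v z" if "x \<in> carrier_vec n" "z \<in> carrier_vec d" for t x z
    using that by (simp add: trivial_extension_eq vec_first_append vec_last_append)
  have emb: "x @\<^sub>v ?o \<in> ?C" if "x \<in> carrier_vec n" for x using that unfolding m_def by simp
  have first: "regular_map m n (\<lambda>w. vec_first w n)" unfolding m_def by (rule regular_map_vec_first)
  have embed: "regular_map n m (\<lambda>x. x @\<^sub>v ?o)" unfolding m_def by (rule regular_map_append) simp
  define \<Theta> where "\<Theta> t y = \<psi> (?\<Phi> t (\<alpha> y))" for t y
  obtain k h y\<^sub>1 where k: "k < m" "h \<in> poly_ring k"
    and below: "\<And>t y i. y \<in> ?C \<Longrightarrow> i < k \<Longrightarrow> \<Theta> t y $ i = y $ i"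
    and y\<^sub>1: "y\<^sub>1 \<in> ?C" "eval_poly h y\<^sub>1 \<noteq> 0"
    and h_fixed: "\<forall>y\<in>?C. (\<forall>t. \<Theta> t y = y) \<longrightarrow> eval_poly h y = 0"
  proof (rule triangular_action_first_moved_coordinate[of m \<Theta> "\<psi> (x\<^sub>0 @\<^sub>v ?o)" t\<^sub>0])
    show "\<Theta> t y \<in> ?C" if "y \<in> ?C" for t y
      unfolding \<Theta>_def using that by (intro \<psi>_car \<Phi>(1) \<alpha>_car)
    show "\<Theta> (s + t) y = \<Theta> s (\<Theta> t y)" if "y \<in> ?C" for s t y
      unfolding \<Theta>_def using that by (simp add: \<alpha>\<psi> \<Phi> \<alpha>_car)
    show "\<Theta> 0 y = y" if "y \<in> ?C" for y
      unfolding \<Theta>_def using that by (simp add: \<psi>\<alpha> \<Phi> \<alpha>_car)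
    show "poly_curve m (\<lambda>t. \<Theta> t y)" if y: "y \<in> ?C" for y
    proof -
      let ?x = "vec_first (\<alpha> y) n" and ?z = "vec_last (\<alpha> y) d"
      have "poly_curve m (\<lambda>t. \<psi> (\<phi> t ?x @\<^sub>v ?z))"
        using regular_Ga_action_curve[OF assms(1), of ?x] regular_map_append[of ?z d n]
        unfolding m_def
        by (intro regular_map_curve[OF \<psi>[unfolded m_def]] regular_map_curve[where T="\<lambda>x. x @\<^sub>v ?z"]) auto
      moreover have "\<Theta> t y = \<psi> (\<phi> t ?x @\<^sub>v ?z)" for t
        using \<alpha>_car[OF y] unfolding \<Theta>_def m_def by (simp add: trivial_extension_eq)
      ultimately show ?thesis by simp
    qed
    show "\<exists>a f. \<forall>i<m. f i \<in> poly_ring i \<and> (\<forall>y\<in>?C. \<Theta> t y $ i = a i * y $ i + eval_poly (f i) y)" for t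
      unfolding \<Theta>_def by (rule jonq)
    show "\<psi> (x\<^sub>0 @\<^sub>v ?o) \<in> ?C" using x\<^sub>0(1) by (intro \<psi>_car emb)
    show "\<Theta> t\<^sub>0 (\<psi> (x\<^sub>0 @\<^sub>v ?o)) \<noteq> \<psi> (x\<^sub>0 @\<^sub>v ?o)"
    proof
      assume "\<Theta> t\<^sub>0 (\<psi> (x\<^sub>0 @\<^sub>v ?o)) = \<psi> (x\<^sub>0 @\<^sub>v ?o)"
      then have "\<alpha> (\<psi> (\<phi> t\<^sub>0 x\<^sub>0 @\<^sub>v ?o)) = \<alpha> (\<psi> (x\<^sub>0 @\<^sub>v ?o))"
        unfolding \<Theta>_def using x\<^sub>0(1) by (simp add: \<alpha>\<psi> emb \<Phi>_eq)
      then have "\<phi> t\<^sub>0 x\<^sub>0 @\<^sub>v ?o = x\<^sub>0 @\<^sub>v ?o"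
        using x\<^sub>0(1) by (simp add: \<alpha>\<psi> emb Ga_actionD(4)[OF act])
      then have "vec_first (\<phi> t\<^sub>0 x\<^sub>0 @\<^sub>v ?o) n = vec_first (x\<^sub>0 @\<^sub>v ?o) n" by simp
      then show False using x\<^sub>0 Ga_actionD(4)[OF act x\<^sub>0(1)] by (simp add: vec_first_append)
    qed
  qed (rule that)
  \<comment> \<open>In the new coordinates \<open>F\<close> is an equation of \<open>X \<times> \<bbbA>\<^sup>d\<close>. Its zeros are fixed points, hence zeros of \<open>h\<close>.\<close>
  define F where "F y = eval_poly f (vec_first (\<alpha> y) n)" for y
  have F_reg: "regular_function m F"
    unfolding F_def
    by (rule regular_function_compose[OF regular_function_eval_poly[OF f(1)] regular_map_compose[OF first \<alpha>]])
  have F_iff: "F y = 0 \<longleftrightarrow> vec_first (\<alpha> y) n \<in> X" for y unfolding F_def by (simp add: X_iff)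
  have F_zeros: "eval_poly h y = 0" if y: "y \<in> ?C" "F y = 0" for y
  proof -
    have "?\<Phi> t (\<alpha> y) = \<alpha> y" for t
      using y(2) \<alpha>_car[OF y(1)] unfolding F_iff X_def fixed_points_def m_def
      by (simp add: trivial_extension_eq)
    then have "\<Theta> t y = y" for t unfolding \<Theta>_def using y(1) by (simp add: \<psi>\<alpha>)
    then show ?thesis using h_fixed y(1) by blast
  qed
  have F_inv: "F (y + s \<cdot>\<^sub>v unit_vec m j) = F y" if j: "k \<le> j" and y: "y \<in> ?C" for j s y
  proof (rule invariant_along_direction[where h="eval_poly h", OF F_reg _ _ _ y\<^sub>1 F_zeros y])
    show "regular_function m (eval_poly h)"
      using k by (intro regular_function_eval_poly poly_ring_mono[of k m]) auto
    show "eval_poly h (y + t \<cdot>\<^sub>v unit_vec m j) = eval_poly h y" if "y \<in> ?C" for y t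
      using that j k by (intro eval_poly_cong[OF k(2)]) (auto simp: unit_vec_def)
  qed simp
  define y\<^sub>p where "y\<^sub>p = \<psi> (p @\<^sub>v ?o)"
  have y\<^sub>p: "y\<^sub>p \<in> ?C" unfolding y\<^sub>p_def by (intro \<psi>_car emb p_car)
  \<comment> \<open>Translations in the coordinates \<open>j \<ge> k\<close> preserve \<open>X \<times> \<bbbA>\<^sup>d\<close>, hence its singular locus, so the component
    of the moved point in \<open>\<bbbA>\<^sup>n\<close> runs along the singular locus of \<open>X\<close> and cannot leave \<open>p\<close>.\<close>
  have \<alpha>_const: "vec_first (\<alpha> (y\<^sub>p + s \<cdot>\<^sub>v unit_vec m j)) n = p" if j: "k \<le> j" for s j
  proof (rule curve_through_isolated_point[OF iso])
    have line: "poly_curve m (\<lambda>s. y\<^sub>p + s \<cdot>\<^sub>v unit_vec m j)" by (rule poly_curve_line[OF y\<^sub>p]) simp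
    show "poly_curve n (\<lambda>s. vec_first (\<alpha> (y\<^sub>p + s \<cdot>\<^sub>v unit_vec m j)) n)"
      by (rule regular_map_curve[OF first regular_map_curve[OF \<alpha> line]])
    have "y\<^sub>p + 0 \<cdot>\<^sub>v unit_vec m j = y\<^sub>p" using y\<^sub>p by (intro eq_vecI) auto
    then show "vec_first (\<alpha> (y\<^sub>p + 0 \<cdot>\<^sub>v unit_vec m j)) n = p"
      unfolding y\<^sub>p_def using p_car by (simp add: \<alpha>\<psi> emb vec_first_append)
    fix s :: 'k
    \<comment> \<open>Translation by \<open>s\<close> in the \<open>j\<close>-th new coordinate, written in the old coordinates.\<close>
    define T where "T s w = \<alpha> (\<psi> w + s \<cdot>\<^sub>v unit_vec m j)" for s w
    have T_reg: "regular_map m m (T s)" for s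
      unfolding T_def
    proof (rule regular_map_compose[OF \<alpha>])
      show "regular_map m m (\<lambda>w. \<psi> w + s \<cdot>\<^sub>v unit_vec m j)"
        unfolding regular_map_def
      proof (intro conjI allI impI)
        show "(\<lambda>w. \<psi> w + s \<cdot>\<^sub>v unit_vec m j) \<in> ?C \<rightarrow> ?C" using \<psi>_car by auto
        fix i assume i: "i < m"
        have "regular_function m (\<lambda>w. \<psi> w $ i + s * unit_vec m j $ i)"
          using function_algebraD(1,2)[OF function_algebra_regular[of m]] \<psi> i
          unfolding regular_map_def by fast
        then show "regular_function m (\<lambda>w. (\<psi> w + s \<cdot>\<^sub>v unit_vec m j) $ i)"
          by (rule regular_function_cong) (use i \<psi>_car in auto)
      qed
    qed
    have T_inv: "T s (T (- s) w) = w" if w: "w \<in> ?C" for s w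
    proof -
      have "\<psi> w + - s \<cdot>\<^sub>v unit_vec m j + s \<cdot>\<^sub>v unit_vec m j = \<psi> w"
        using \<psi>_car[OF w] by (intro eq_vecI) auto
      then show ?thesis unfolding T_def using w by (simp add: \<psi>\<alpha> \<alpha>\<psi> \<psi>_car)
    qed
    have T_X: "vec_first (T s w) n \<in> X" if w: "w \<in> ?C" "vec_first w n \<in> X" for w
    proof -
      have "F (\<psi> w) = 0" using w by (simp add: F_iff \<alpha>\<psi>)
      then have "F (\<psi> w + s \<cdot>\<^sub>v unit_vec m j) = 0" using F_inv[OF j \<psi>_car[OF w(1)]] by simp
      then show ?thesis unfolding F_iff T_def .
    qed
    have "singular_at n X (vec_first (T s (p @\<^sub>v ?o)) n)"
    proof (rule singular_at_transport[OF X pX p_sing])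
      show "T s (T (- s) w) = w" "T (- s) (T s w) = w" if "w \<in> carrier_vec (n + d)" for w
        using T_inv[of w s] T_inv[of w "- s"] that unfolding m_def by auto
    qed (use T_reg T_X in \<open>auto simp: m_def\<close>)
    moreover have "vec_first (T s (p @\<^sub>v ?o)) n \<in> X"
      using T_X[OF emb[OF p_car]] pX p_car by (simp add: vec_first_append)
    ultimately show "vec_first (\<alpha> (y\<^sub>p + s \<cdot>\<^sub>v unit_vec m j)) n \<in> hypersurface_singular_locus n X"
      using hypersurface_singular_locus_iff[OF X] n unfolding T_def y\<^sub>p_def by blast
  qed
  \<comment> \<open>Replacing the coordinates \<open>j \<ge> k\<close> by their values at \<open>y\<^sub>p\<close> discards everything that the action moves. By
    \<open>\<alpha>_const\<close> this does not change the component of \<open>\<alpha> y\<close> in \<open>\<bbbA>\<^sup>n\<close> to first order at \<open>y\<^sub>p\<close>.\<close>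
  define freeze where "freeze y = vec m (\<lambda>i. if i < k then y $ i else y\<^sub>p $ i)" for y
  have freeze: "regular_map m m freeze"
    unfolding regular_map_def
  proof (intro conjI allI impI)
    fix i assume i: "i < m"
    have "regular_function m (\<lambda>y. if i < k then y $ i else y\<^sub>p $ i)"
      using regular_function_coordinate[OF i] function_algebraD(1)[OF function_algebra_regular[of m]]
      by (cases "i < k") auto
    then show "regular_function m (\<lambda>y. freeze y $ i)"
      by (rule regular_function_cong) (use i in \<open>simp add: freeze_def\<close>)
  qed (simp add: freeze_def)
  define R where "R x = vec_first (\<alpha> (freeze (\<psi> (x @\<^sub>v ?o)))) n" for x
  have R: "regular_map n n R"
    unfolding R_def
    by (intro regular_map_compose[OF first] regular_map_compose[OF \<alpha>] regular_map_compose[OF freeze]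
        regular_map_compose[OF \<psi> embed])
  have R_inv: "R (\<phi> t x) = R x" if x: "x \<in> carrier_vec n" for t x
  proof -
    have "\<psi> (\<phi> t x @\<^sub>v ?o) = \<Theta> t (\<psi> (x @\<^sub>v ?o))"
      unfolding \<Theta>_def using x by (simp add: \<alpha>\<psi> emb \<Phi>_eq)
    then have "freeze (\<psi> (\<phi> t x @\<^sub>v ?o)) = freeze (\<psi> (x @\<^sub>v ?o))"
      unfolding freeze_def using below[OF \<psi>_car[OF emb[OF x]]] by (intro eq_vecI) auto
    then show ?thesis unfolding R_def by simp
  qed
  have R_critical: "critical n (\<lambda>x. R x $ l - x $ l) p" if l: "l < n" for l
  proof -
    define E where "E y = vec_first (\<alpha> (freeze y)) n $ l - vec_first (\<alpha> y) n $ l" for y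
    have E: "regular_function m E"
    proof -
      have "regular_function m (\<lambda>y. vec_first (\<alpha> (freeze y)) n $ l)"
        "regular_function m (\<lambda>y. vec_first (\<alpha> y) n $ l)"
        using l regular_map_compose[OF first regular_map_compose[OF \<alpha> freeze]]
          regular_map_compose[OF first \<alpha>] unfolding regular_map_def by auto
      then show ?thesis
        unfolding E_def using function_algebra_diff[OF function_algebra_regular[of m]] by fast
    qed
    have "critical m E y\<^sub>p"
    proof (rule critical_axes[OF E y\<^sub>p])
      fix i assume i: "i < m"
      have "E (y\<^sub>p + t \<cdot>\<^sub>v unit_vec m i) = 0" for t
      proof (cases "i < k")
        case True
        have "freeze (y\<^sub>p + t \<cdot>\<^sub>v unit_vec m i) = y\<^sub>p + t \<cdot>\<^sub>v unit_vec m i"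
          unfolding freeze_def using y\<^sub>p i True by (intro eq_vecI) auto
        then show ?thesis unfolding E_def by simp
      next
        case False
        have "freeze (y\<^sub>p + t \<cdot>\<^sub>v unit_vec m i) = y\<^sub>p + 0 \<cdot>\<^sub>v unit_vec m i"
          unfolding freeze_def using y\<^sub>p i False by (intro eq_vecI) auto
        then show ?thesis unfolding E_def using False by (simp add: \<alpha>_const)
      qed
      then show "\<exists>r. (\<forall>t. E (y\<^sub>p + t \<cdot>\<^sub>v unit_vec m i) = poly r t) \<and> coeff r 1 = 0"
        by (intro exI[of _ 0]) simp
    qed
    then have "critical n (\<lambda>x. E (\<psi> (x @\<^sub>v ?o))) p"
      unfolding y\<^sub>p_def by (rule critical_pullback[OF _ regular_map_compose[OF \<psi> embed]])
    then show ?thesis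
      by (rule critical_cong) (simp add: E_def R_def \<alpha>\<psi> emb vec_first_append)
  qed
  \<comment> \<open>The invariant map \<open>R\<close> is the identity to first order at the fixed point \<open>p\<close>, so the action is trivial.\<close>
  have "\<phi> t\<^sub>0 x\<^sub>0 = x\<^sub>0"
  proof (rule trivial_of_invariants[OF regular_Ga_action_regular_map[OF assms(1)] _ p_car R R_inv R_critical x\<^sub>0(1)])
    show "\<phi> t\<^sub>0 p = p" using pX unfolding X_def fixed_points_def by blast
  qed
  then show False using x\<^sub>0(2) by simp
qed

end
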